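(* For every $k<\omega$, the variety of Heyting algebras $\mathcal{V}_k$ is regularly $k$-finite (in particular $k$-finite) but not $(k+1)$-finite.
   Context: For a poset $(X,\leq)$ and $x\in X$, write $x^\uparrow=\{y\in X\mid x\leq y\}$; for $Y\subseteq X$ write $Y^\downarrow=\{x\in X\mid \exists y\in Y,\ x\leq y\}$ and $Y^c=X\setminus Y$. For $n<\omega$, let $\mathfrak{E}_n=(P_n,\leq,\tau)$ be the following ordered topological space. Its points are $P_n=\{x^l_i\mid l\leq 2^n,\ i<\omega\}\cup\{x_\infty\}$ (with $l$ ranging over the $2^n+1$ values $0,\dots,2^n$). The partial order $\leq$ consists of the reflexive pairs together with exactly: $x^l_{i+1}\leq x^{l'}_i$ for all $i<\omega$ and $l,l'\leq 2^n$ with $l'\neq l+1$; $x^l_{i+t}\leq x^{l'}_i$ for all $l,l'\leq 2^n$, $i<\omega$, $t\geq 2$; and $x_\infty\leq x^l_i$ for all $l\leq 2^n$, $i<\omega$. The topology $\tau$ is generated by the subbasis $\{(x^l_i)^\uparrow\mid l\leq 2^n,i<\omega\}\cup\{((x^l_i)^\uparrow)^c\mid l\leq 2^n,i<\omega\}\cup\{\emptyset,(x_\infty)^\uparrow\}$. The space $\mathfrak{E}_n$ is an Esakia space. $H_k$ denotes the Heyting algebra of clopen upsets of $\mathfrak{E}_k$, with $\wedge=\cap$, $\vee=\cup$, $0=\emptyset$, $1=P_k$, and $U\to V=((U\setminus V)^\downarrow)^c$. $\mathcal{V}_k=\mathsf{Var}(H_k)$ is the variety generated by $H_k$, i.e.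 the class of all Heyting algebras satisfying every equation (in the language $\{\wedge,\vee,\to,0,1\}$) valid in $H_k$. An algebra $A$ is $k$-generated if there is $G\subseteq A$ with $|G|=k$ such that the smallest subalgebra of $A$ containing $G$ is $A$. A variety $\mathcal{V}$ is $k$-finite if every $k$-generated $A\in\mathcal{V}$ is finite; it is regularly $k$-finite if it is $k$-finite and, moreover, there are only finitely many $k$-generated algebras in $\mathcal{V}$ up to isomorphism. *)

theory Defs
  imports "HOL-Analysis.Analysis" "HOL-Algebra.Congruence"
begin

section \<open>Heyting algebras\<close>

record 'a heyting_alg = "'a partial_object" +
  hmeet :: "'a \<Rightarrow> 'a \<Rightarrow> 'a" (infixl "\<sqinter>\<index>" 70)
  hjoin :: "'a \<Rightarrow> 'a \<Rightarrow> 'a" (infixl "\<squnion>\<index>" 65)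
  himp :: "'a \<Rightarrow> 'a \<Rightarrow> 'a" (infixr "\<rightharpoonup>\<index>" 60)
  hbot :: 'a ("\<bottom>\<index>")
  htop :: 'a ("\<top>\<index>")

definition closed_under_ops :: "'a heyting_alg \<Rightarrow> 'a set \<Rightarrow> bool" where
  "closed_under_ops A S \<longleftrightarrow> \<bottom>\<^bsub>A\<^esub> \<in> S \<and> \<top>\<^bsub>A\<^esub> \<in> S \<and>
     (\<forall>x\<in>S. \<forall>y\<in>S. x \<sqinter>\<^bsub>A\<^esub> y \<in> S \<and> x \<squnion>\<^bsub>A\<^esub> y \<in> S \<and> x \<rightharpoonup>\<^bsub>A\<^esub> y \<in> S)"

text \<open>The lattice order is \<open>x \<le> y \<longleftrightarrow> x \<sqinter> y = x\<close>; the axiom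
  \<open>residuation\<close> reads \<open>x \<sqinter> y \<le> z \<longleftrightarrow> x \<le> (y \<rightharpoonup> z)\<close>.
  The one-element algebra is a Heyting algebra.\<close>

locale heyting_algebra =
  fixes A :: "'a heyting_alg" (structure)
  assumes closed: "closed_under_ops A (carrier A)"
    and meet_assoc: "\<lbrakk>x \<in> carrier A; y \<in> carrier A; z \<in> carrier A\<rbrakk>
          \<Longrightarrow> (x \<sqinter> y) \<sqinter> z = x \<sqinter> (y \<sqinter> z)"
    and meet_comm: "\<lbrakk>x \<in> carrier A; y \<in> carrier A\<rbrakk> \<Longrightarrow> x \<sqinter> y = y \<sqinter> x"
    and join_assoc: "\<lbrakk>x \<in> carrier A; y \<in> carrier A; z \<in> carrier A\<rbrakk>
          \<Longrightarrow> (x \<squnion> y) \<squnion> z = x \<squnion> (y \<squnion> z)"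
    and join_comm: "\<lbrakk>x \<in> carrier A; y \<in> carrier A\<rbrakk> \<Longrightarrow> x \<squnion> y = y \<squnion> x"
    and meet_absorb: "\<lbrakk>x \<in> carrier A; y \<in> carrier A\<rbrakk> \<Longrightarrow> x \<sqinter> (x \<squnion> y) = x"
    and join_absorb: "\<lbrakk>x \<in> carrier A; y \<in> carrier A\<rbrakk> \<Longrightarrow> x \<squnion> (x \<sqinter> y) = x"
    and bot_least: "x \<in> carrier A \<Longrightarrow> \<bottom> \<sqinter> x = \<bottom>"
    and top_greatest: "x \<in> carrier A \<Longrightarrow> x \<sqinter> \<top> = x"
    and residuation: "\<lbrakk>x \<in> carrier A; y \<in> carrier A; z \<in> carrier A\<rbrakk>
          \<Longrightarrow> (x \<sqinter> y) \<sqinter> z = x \<sqinter> y \<longleftrightarrow> x \<sqinter> (y \<rightharpoonup> z) = x"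

definition subalgebra :: "'a heyting_alg \<Rightarrow> 'a set \<Rightarrow> bool" where
  "subalgebra A S \<longleftrightarrow> S \<subseteq> carrier A \<and> closed_under_ops A S"

definition generated_subalgebra :: "'a heyting_alg \<Rightarrow> 'a set \<Rightarrow> 'a set" where
  "generated_subalgebra A G = \<Inter>{S. subalgebra A S \<and> G \<subseteq> S}"

text \<open>The conjunct \<open>finite G\<close> matters for \<open>k = 0\<close>, since infinite sets have \<open>card\<close> 0.\<close>

definition generated_by_card :: "nat \<Rightarrow> 'a heyting_alg \<Rightarrow> bool" where
  "generated_by_card k A \<longleftrightarrow>
     (\<exists>G \<subseteq> carrier A. finite G \<and> card G = k \<and> generated_subalgebra A G = carrier A)"

definition heyting_hom :: "'a heyting_alg \<Rightarrow> 'b heyting_alg \<Rightarrow> ('a \<Rightarrow> 'b) \<Rightarrow> bool" where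
  "heyting_hom A B h \<longleftrightarrow> h ` carrier A \<subseteq> carrier B \<and>
     h \<bottom>\<^bsub>A\<^esub> = \<bottom>\<^bsub>B\<^esub> \<and> h \<top>\<^bsub>A\<^esub> = \<top>\<^bsub>B\<^esub> \<and>
     (\<forall>x\<in>carrier A. \<forall>y\<in>carrier A.
        h (x \<sqinter>\<^bsub>A\<^esub> y) = h x \<sqinter>\<^bsub>B\<^esub> h y \<and>
        h (x \<squnion>\<^bsub>A\<^esub> y) = h x \<squnion>\<^bsub>B\<^esub> h y \<and>
        h (x \<rightharpoonup>\<^bsub>A\<^esub> y) = h x \<rightharpoonup>\<^bsub>B\<^esub> h y)"

definition heyting_iso :: "'a heyting_alg \<Rightarrow> 'b heyting_alg \<Rightarrow> bool" where
  "heyting_iso A B \<longleftrightarrow> (\<exists>h. heyting_hom A B h \<and> bij_betw h (carrier A) (carrier B))"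


section \<open>Equations and varieties\<close>

datatype hterm =
    Var nat
  | Bot
  | Top
  | Meet hterm hterm
  | Join hterm hterm
  | Imp hterm hterm

primrec hterm_val :: "'a heyting_alg \<Rightarrow> (nat \<Rightarrow> 'a) \<Rightarrow> hterm \<Rightarrow> 'a" where
  "hterm_val A v (Var n) = v n"
| "hterm_val A v Bot = \<bottom>\<^bsub>A\<^esub>"
| "hterm_val A v Top = \<top>\<^bsub>A\<^esub>"
| "hterm_val A v (Meet s t) = hterm_val A v s \<sqinter>\<^bsub>A\<^esub> hterm_val A v t"
| "hterm_val A v (Join s t) = hterm_val A v s \<squnion>\<^bsub>A\<^esub> hterm_val A v t"
| "hterm_val A v (Imp s t) = hterm_val A v s \<rightharpoonup>\<^bsub>A\<^esub> hterm_val A v t"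

definition valid_eq :: "'a heyting_alg \<Rightarrow> hterm \<Rightarrow> hterm \<Rightarrow> bool" where
  "valid_eq A s t \<longleftrightarrow> (\<forall>v. range v \<subseteq> carrier A \<longrightarrow> hterm_val A v s = hterm_val A v t)"

text \<open>HOL has no class of all algebras: \<open>generated_variety H :: 'a heyting_alg set\<close> consists of
  the members of the variety generated by \<open>H\<close> whose elements have type \<open>'a\<close>, which is
  unrelated to the type of the elements of \<open>H\<close>.\<close>

definition generated_variety :: "'b heyting_alg \<Rightarrow> 'a heyting_alg set" where
  "generated_variety H =
     {A. heyting_algebra A \<and> (\<forall>s t. valid_eq H s t \<longrightarrow> valid_eq A s t)}"

definition k_finite :: "nat \<Rightarrow> 'a heyting_alg set \<Rightarrow> bool" where
  "k_finite k \<V> \<longleftrightarrow> (\<forall>A\<in>\<V>. generated_by_card k A \<longrightarrow> finite (carrier A))"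

definition regularly_k_finite :: "nat \<Rightarrow> 'a heyting_alg set \<Rightarrow> bool" where
  "regularly_k_finite k \<V> \<longleftrightarrow> k_finite k \<V> \<and>
     (\<exists>F. finite F \<and> F \<subseteq> {A\<in>\<V>. generated_by_card k A} \<and>
          (\<forall>A\<in>\<V>. generated_by_card k A \<longrightarrow> (\<exists>B\<in>F. heyting_iso A B)))"


section \<open>The ordered topological spaces\<close>

text \<open>\<open>Pt l i\<close> is the point \<open>x\<close> with superscript \<open>l\<close> and subscript \<open>i\<close>.\<close>

datatype pt = Pt nat nat | PInf

definition points :: "nat \<Rightarrow> pt set" where
  "points n = {Pt l i |l i. l \<le> 2 ^ n} \<union> {PInf}"

inductive pt_le :: "nat \<Rightarrow> pt \<Rightarrow> pt \<Rightarrow> bool" for n :: nat where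
  refl: "x \<in> points n \<Longrightarrow> pt_le n x x"
| step: "\<lbrakk>l \<le> 2 ^ n; l' \<le> 2 ^ n; l' \<noteq> l + 1\<rbrakk> \<Longrightarrow> pt_le n (Pt l (i + 1)) (Pt l' i)"
| jump: "\<lbrakk>l \<le> 2 ^ n; l' \<le> 2 ^ n; t \<ge> 2\<rbrakk> \<Longrightarrow> pt_le n (Pt l (i + t)) (Pt l' i)"
| inf: "l \<le> 2 ^ n \<Longrightarrow> pt_le n PInf (Pt l i)"

definition up :: "nat \<Rightarrow> pt \<Rightarrow> pt set" where
  "up n x = {y \<in> points n. pt_le n x y}"

definition down :: "nat \<Rightarrow> pt set \<Rightarrow> pt set" where
  "down n Y = {x \<in> points n. \<exists>y\<in>Y. pt_le n x y}"

definition pt_topology :: "nat \<Rightarrow> pt topology" where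
  "pt_topology n = topology_generated_by
     ({up n (Pt l i) |l i. l \<le> 2 ^ n} \<union> {points n - up n (Pt l i) |l i. l \<le> 2 ^ n} \<union>
      {{}, up n PInf})"

definition is_upset :: "nat \<Rightarrow> pt set \<Rightarrow> bool" where
  "is_upset n U \<longleftrightarrow> U \<subseteq> points n \<and> (\<forall>x\<in>U. \<forall>y. pt_le n x y \<longrightarrow> y \<in> U)"

definition H :: "nat \<Rightarrow> pt set heyting_alg" where
  "H k = \<lparr>carrier = {U. openin (pt_topology k) U \<and> closedin (pt_topology k) U \<and> is_upset k U},
          hmeet = (\<inter>), hjoin = (\<union>),
          himp = (\<lambda>U V. points k - down k (U - V)),
          hbot = {}, htop = points k\<rparr>"

definition variety_V :: "nat \<Rightarrow> 'a heyting_alg set" where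
  "variety_V k = generated_variety (H k)"

end

theory Submission
  imports Defs
begin

text \<open>
  Write \<open>n = 2 ^ k\<close>.  The space has \<open>n + 1\<close> columns.  The point \<open>Pt a i\<close> of level \<open>i\<close> sees, that
  is, lies below, all points of smaller level except \<open>Pt (a + 1) (i - 1)\<close> (when that column exists).
  Levels are called preceding or deeper by their index, so the deeper ones are the lower ones in
  the order.  A valuation of \<open>k\<close> variables by clopen upsets colours the points with subsets of
  \<open>{..<k}\<close>, so it uses at most \<open>n\<close> colours, one fewer than there are columns; with \<open>k + 1\<close>
  variables all points of level \<open>0\<close> can get distinct colours.  The whole theorem rests on this
  difference.

  Regular \<open>k\<close>-finiteness.  Two points of a level are twins if they have the same colour and
  neither of them misses a point without twins.  If \<open>Pt (a + 1) i\<close> has a twin, then missing it is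
  harmless for \<open>Pt a (i + 1)\<close>, which sees the twin instead.  The key inequality
  \<open>card_classes\<close> says that at every level the number of classes up to twinship is at most
  \<open>2 ^ u\<close>, where \<open>u\<close> is the number of variables that have already distinguished two points of
  one level; hence there are at most \<open>n\<close> classes and twins never run out.  While the colour stays
  constant, the columns of the points without twins move left by one at each level.  After more than
  \<open>n\<close> steps none is left, and from then on each level can be identified with the preceding
  one until the colour changes.  The colour changes at no more than \<open>3 k\<close> levels, so each
  valuation factors through a quotient of the space whose size is bounded in terms of \<open>k\<close> alone
  (\<open>bisimulation_map_collapse\<close>, \<open>collapse_image\<close>).  There are only finitely many Kripke models of
  bounded size, so only finitely many terms in \<open>k\<close> variables up to equations valid in \<open>H k\<close>
  (\<open>finitely_many_terms\<close>), and every \<open>k\<close>-generated algebra of the variety is determined up to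
  isomorphism by which of these finitely many terms it identifies.

  Failure of \<open>(k + 1)\<close>-finiteness.  Distinguishing the points of level \<open>0\<close> by the \<open>k + 1\<close> binary
  digits of the column, each principal upset becomes definable from those of the preceding level,
  so \<open>H k\<close> itself is \<open>(k + 1)\<close>-generated.  It is countably infinite, and can therefore be copied
  into any infinite type.
\<close>

section \<open>Terms and generated algebras\<close>

primrec hvars :: "hterm \<Rightarrow> nat set" where
  "hvars (Var j) = {j}"
| "hvars Bot = {}"
| "hvars Top = {}"
| "hvars (Meet s t) = hvars s \<union> hvars t"
| "hvars (Join s t) = hvars s \<union> hvars t"
| "hvars (Imp s t) = hvars s \<union> hvars t"

definition terms_in :: "nat \<Rightarrow> hterm set" where
  "terms_in k = {t. hvars t \<subseteq> {..<k}}"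

lemma hterm_val_closed:
  assumes "closed_under_ops A S" "range v \<subseteq> S"
  shows "hterm_val A v t \<in> S"
  using assms by (induction t) (auto simp: closed_under_ops_def)

lemma terms_in_intros:
  "j < k \<Longrightarrow> Var j \<in> terms_in k" "Bot \<in> terms_in k" "Top \<in> terms_in k"
  "s \<in> terms_in k \<Longrightarrow> t \<in> terms_in k \<Longrightarrow> Meet s t \<in> terms_in k"
  "s \<in> terms_in k \<Longrightarrow> t \<in> terms_in k \<Longrightarrow> Join s t \<in> terms_in k"
  "s \<in> terms_in k \<Longrightarrow> t \<in> terms_in k \<Longrightarrow> Imp s t \<in> terms_in k"
  by (auto simp: terms_in_def)

lemma closed_under_ops_term_values:
  "closed_under_ops A (hterm_val A v ` terms_in k)"
  unfolding closed_under_ops_def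
proof (intro conjI ballI)
  let ?S = "hterm_val A v ` terms_in k"
  show "\<bottom>\<^bsub>A\<^esub> \<in> ?S" by (rule image_eqI[where x = Bot]) (simp_all add: terms_in_intros)
  show "\<top>\<^bsub>A\<^esub> \<in> ?S" by (rule image_eqI[where x = Top]) (simp_all add: terms_in_intros)
  fix x y assume "x \<in> ?S" "y \<in> ?S"
  then obtain s t where "s \<in> terms_in k" "t \<in> terms_in k"
    "x = hterm_val A v s" "y = hterm_val A v t" by blast
  thus "x \<sqinter>\<^bsub>A\<^esub> y \<in> ?S" "x \<squnion>\<^bsub>A\<^esub> y \<in> ?S" "x \<rightharpoonup>\<^bsub>A\<^esub> y \<in> ?S"
    using image_eqI[where x = "Meet s t" and f = "hterm_val A v"]
      image_eqI[where x = "Join s t" and f = "hterm_val A v"]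
      image_eqI[where x = "Imp s t" and f = "hterm_val A v"]
    by (simp_all add: terms_in_intros)
qed

lemma generated_by_card_terms:
  assumes A: "heyting_algebra A" and gen: "generated_by_card k A"
  obtains v where "range v \<subseteq> carrier A" "carrier A = hterm_val A v ` terms_in k"
proof -
  have closed: "closed_under_ops A (carrier A)"
    using A by (rule heyting_algebra.closed)
  obtain G where G: "G \<subseteq> carrier A" "finite G" "card G = k"
    "generated_subalgebra A G = carrier A"
    using gen by (auto simp: generated_by_card_def)
  obtain g where g: "bij_betw g {..<k} G"
    using ex_bij_betw_nat_finite[OF G(2)] G(3) by (auto simp: atLeast0LessThan)
  define v where "v j = (if j < k then g j else \<bottom>\<^bsub>A\<^esub>)" for j
  have v: "range v \<subseteq> carrier A"
    using g G(1) closed by (auto simp: v_def closed_under_ops_def bij_betw_def)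
  have sub: "hterm_val A v ` terms_in k \<subseteq> carrier A"
    using hterm_val_closed[OF closed v] by auto
  have "g j \<in> hterm_val A v ` terms_in k" if "j < k" for j
    using that by (intro image_eqI[where x = "Var j"]) (auto simp: v_def terms_in_intros)
  hence "G \<subseteq> hterm_val A v ` terms_in k"
    using g by (auto simp: bij_betw_def)
  hence "generated_subalgebra A G \<subseteq> hterm_val A v ` terms_in k"
    using closed_under_ops_term_values[of A v k] sub
    unfolding generated_subalgebra_def subalgebra_def by blast
  with that v sub G(4) show thesis by blast
qed

text \<open>A presented algebra is the term algebra modulo the kernel of the evaluation map, so
  presentations with equal kernels yield isomorphic algebras.\<close>

lemma heyting_iso_if_same_kernel:
  fixes A :: "'a heyting_alg" and B :: "'b heyting_alg"
  assumes A: "carrier A = hterm_val A v ` terms_in k"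
    and B: "carrier B = hterm_val B w ` terms_in k"
    and ker: "\<And>s t. s \<in> terms_in k \<Longrightarrow> t \<in> terms_in k \<Longrightarrow>
      hterm_val A v s = hterm_val A v t \<longleftrightarrow> hterm_val B w s = hterm_val B w t"
  shows "heyting_iso A B"
proof -
  define h where "h x = hterm_val B w (SOME t. t \<in> terms_in k \<and> hterm_val A v t = x)" for x
  have h: "h (hterm_val A v t) = hterm_val B w t" if "t \<in> terms_in k" for t
  proof -
    have "\<exists>s. s \<in> terms_in k \<and> hterm_val A v s = hterm_val A v t"
      using that by blast
    from someI_ex[OF this] show ?thesis
      using ker that unfolding h_def by blast
  qed
  have "bij_betw h (carrier A) (carrier B)"
    unfolding bij_betw_def inj_on_def A B by (auto simp: h ker image_image)
  moreover have "heyting_hom A B h"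
    unfolding heyting_hom_def A B
    using h[OF terms_in_intros(2)] h[OF terms_in_intros(3)]
      h[OF terms_in_intros(4)] h[OF terms_in_intros(5)] h[OF terms_in_intros(6)]
    by (auto simp: h)
  ultimately show ?thesis
    by (auto simp: heyting_iso_def)
qed

text \<open>Each term can be replaced by a representative in \<open>T\<close>, so a presentation \<open>v\<close> of an
  algebra is determined up to isomorphism by which pairs from the finite set \<open>T \<times> T\<close> it
  identifies.\<close>

lemma regularly_k_finite_if_finitely_many_terms:
  fixes B :: "'b heyting_alg"
  assumes T: "finite T" "T \<subseteq> terms_in k"
    and repr: "\<And>t. t \<in> terms_in k \<Longrightarrow> \<exists>t'\<in>T. valid_eq B t t'"
  shows "regularly_k_finite k (generated_variety B :: 'a heyting_alg set)"
proof -
  define presents :: "'a heyting_alg \<Rightarrow> (nat \<Rightarrow> 'a) \<Rightarrow> bool" where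
    "presents A v \<longleftrightarrow> range v \<subseteq> carrier A \<and> carrier A = hterm_val A v ` terms_in k" for A v
  define ker :: "'a heyting_alg \<Rightarrow> (nat \<Rightarrow> 'a) \<Rightarrow> (hterm \<times> hterm) set" where
    "ker A v = {(s, t) \<in> T \<times> T. hterm_val A v s = hterm_val A v t}" for A v
  define gens :: "'a heyting_alg set" where
    "gens = {A \<in> generated_variety B. generated_by_card k A}"
  have pres: "\<exists>v. presents A v" if "A \<in> gens" for A
  proof -
    have "heyting_algebra A" "generated_by_card k A"
      using that by (auto simp: gens_def generated_variety_def)
    from generated_by_card_terms[OF this] show ?thesis
      unfolding presents_def by metis
  qed
  have red: "\<exists>t'\<in>T. hterm_val A v t = hterm_val A v t'"
    if "A \<in> gens" "presents A v" "t \<in> terms_in k" for A v t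
  proof -
    obtain t' where t': "t' \<in> T" "valid_eq B t t'"
      using repr \<open>t \<in> terms_in k\<close> by blast
    hence "valid_eq A t t'"
      using that by (auto simp: gens_def generated_variety_def)
    thus ?thesis
      using t'(1) that by (auto simp: valid_eq_def presents_def)
  qed
  have iso: "heyting_iso A A'"
    if A: "A \<in> gens" "presents A v" and A': "A' \<in> gens" "presents A' v'"
      and eq: "ker A v = ker A' v'" for A A' v v'
  proof (rule heyting_iso_if_same_kernel)
    show "carrier A = hterm_val A v ` terms_in k" "carrier A' = hterm_val A' v' ` terms_in k"
      using A A' by (auto simp: presents_def)
    fix s t assume st: "s \<in> terms_in k" "t \<in> terms_in k"
    have "\<exists>s'\<in>T. valid_eq B s s'" "\<exists>t'\<in>T. valid_eq B t t'"
      using repr st by blast+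
    then obtain s' t' where s't': "s' \<in> T" "t' \<in> T" "valid_eq B s s'" "valid_eq B t t'"
      by blast
    have "hterm_val C u s = hterm_val C u s' \<and> hterm_val C u t = hterm_val C u t'"
      if "C \<in> gens" "presents C u" for C u
      using that s't' by (auto simp: gens_def generated_variety_def valid_eq_def presents_def)
    moreover have "(s', t') \<in> ker A v \<longleftrightarrow> (s', t') \<in> ker A' v'"
      using eq by simp
    ultimately show "hterm_val A v s = hterm_val A v t \<longleftrightarrow> hterm_val A' v' s = hterm_val A' v' t"
      using A A' s't'(1,2) by (simp add: ker_def)
  qed
  define K where "K = {ker A v |A v. A \<in> gens \<and> presents A v}"
  have "finite K"
    by (rule finite_subset[of _ "Pow (T \<times> T)"]) (auto simp: K_def ker_def T)
  define pick where "pick \<kappa> = (SOME A. A \<in> gens \<and> (\<exists>v. presents A v \<and> ker A v = \<kappa>))" for \<kappa>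
  have pick: "pick \<kappa> \<in> gens \<and> (\<exists>v. presents (pick \<kappa>) v \<and> ker (pick \<kappa>) v = \<kappa>)"
    if "\<kappa> \<in> K" for \<kappa>
  proof -
    have "\<exists>A. A \<in> gens \<and> (\<exists>v. presents A v \<and> ker A v = \<kappa>)"
      using that by (auto simp: K_def)
    from someI_ex[OF this] show ?thesis unfolding pick_def .
  qed
  have "finite (carrier A)" if "A \<in> gens" for A
  proof -
    obtain v where v: "presents A v" using pres \<open>A \<in> gens\<close> by blast
    hence "carrier A \<subseteq> hterm_val A v ` T"
      using red[OF that v] by (force simp: presents_def)
    thus ?thesis using T(1) finite_subset by blast
  qed
  hence "k_finite k (generated_variety B :: 'a heyting_alg set)"
    by (auto simp: k_finite_def gens_def)
  moreover have "\<exists>C\<in>pick ` K. heyting_iso A C" if "A \<in> gens" for A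
  proof -
    obtain v where v: "presents A v" using pres \<open>A \<in> gens\<close> by blast
    hence "ker A v \<in> K" using that by (auto simp: K_def)
    with pick[OF this] iso[OF that v] show ?thesis by blast
  qed
  moreover have "pick ` K \<subseteq> gens" using pick by auto
  ultimately show ?thesis
    unfolding regularly_k_finite_def gens_def using \<open>finite K\<close>
    by (intro conjI exI[of _ "pick ` K"]) auto
qed

section \<open>Transport along a bijection\<close>

lemma hterm_val_hom:
  fixes v :: "nat \<Rightarrow> 'a"
  assumes A: "closed_under_ops A (carrier A)" and f: "heyting_hom A B f"
    and v: "range v \<subseteq> carrier A"
  shows "hterm_val B (f \<circ> v) t = f (hterm_val A v t)"
  using f hterm_val_closed[OF A v] by (induction t) (auto simp: heyting_hom_def)

text \<open>The target of the copy may be any type into which the carrier injects; this is how the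
  set algebra \<open>H k\<close> reaches an arbitrary infinite type.\<close>

lemma heyting_copy:
  fixes A :: "'b heyting_alg" and f :: "'b \<Rightarrow> 'a"
  assumes A: "closed_under_ops A (carrier A)" and f: "inj_on f (carrier A)"
  obtains B where "heyting_hom A B f" "bij_betw f (carrier A) (carrier B)"
proof -
  define g where "g = inv_into (carrier A) f"
  define B where "B = \<lparr>carrier = f ` carrier A,
    hmeet = (\<lambda>x y. f (g x \<sqinter>\<^bsub>A\<^esub> g y)), hjoin = (\<lambda>x y. f (g x \<squnion>\<^bsub>A\<^esub> g y)),
    himp = (\<lambda>x y. f (g x \<rightharpoonup>\<^bsub>A\<^esub> g y)), hbot = f \<bottom>\<^bsub>A\<^esub>, htop = f \<top>\<^bsub>A\<^esub>\<rparr>"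
  have "g (f x) = x" if "x \<in> carrier A" for x
    using f that by (simp add: g_def)
  hence "heyting_hom A B f"
    by (auto simp: heyting_hom_def B_def)
  with f that show thesis
    by (simp add: bij_betw_def B_def)
qed

lemma closed_under_ops_hom_image:
  assumes A: "closed_under_ops A (carrier A)" and f: "heyting_hom A B f"
  shows "closed_under_ops B (f ` carrier A)"
  unfolding closed_under_ops_def
proof (intro conjI ballI)
  show "\<bottom>\<^bsub>B\<^esub> \<in> f ` carrier A" "\<top>\<^bsub>B\<^esub> \<in> f ` carrier A"
    using A f unfolding closed_under_ops_def heyting_hom_def by (metis imageI)+
  fix x y assume "x \<in> f ` carrier A" "y \<in> f ` carrier A"
  then obtain a b where "a \<in> carrier A" "x = f a" "b \<in> carrier A" "y = f b" by blast
  thus "x \<sqinter>\<^bsub>B\<^esub> y \<in> f ` carrier A" "x \<squnion>\<^bsub>B\<^esub> y \<in> f ` carrier A"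
    "x \<rightharpoonup>\<^bsub>B\<^esub> y \<in> f ` carrier A"
    using A f unfolding closed_under_ops_def heyting_hom_def by (metis imageI)+
qed

lemma heyting_algebra_iso:
  assumes A: "heyting_algebra A" and f: "heyting_hom A B f"
    and bij: "bij_betw f (carrier A) (carrier B)"
  shows "heyting_algebra B"
proof -
  interpret A: heyting_algebra A by (rule A)
  have B: "carrier B = f ` carrier A" and inj: "inj_on f (carrier A)"
    using bij by (auto simp: bij_betw_def)
  have mem: "\<bottom>\<^bsub>A\<^esub> \<in> carrier A" "\<top>\<^bsub>A\<^esub> \<in> carrier A"
    "\<And>x y. x \<in> carrier A \<Longrightarrow> y \<in> carrier A \<Longrightarrow> x \<sqinter>\<^bsub>A\<^esub> y \<in> carrier A"
    "\<And>x y. x \<in> carrier A \<Longrightarrow> y \<in> carrier A \<Longrightarrow> x \<squnion>\<^bsub>A\<^esub> y \<in> carrier A"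
    "\<And>x y. x \<in> carrier A \<Longrightarrow> y \<in> carrier A \<Longrightarrow> x \<rightharpoonup>\<^bsub>A\<^esub> y \<in> carrier A"
    using A.closed by (auto simp: closed_under_ops_def)
  have f_ops: "\<bottom>\<^bsub>B\<^esub> = f \<bottom>\<^bsub>A\<^esub>" "\<top>\<^bsub>B\<^esub> = f \<top>\<^bsub>A\<^esub>"
    "\<And>x y. x \<in> carrier A \<Longrightarrow> y \<in> carrier A \<Longrightarrow> f x \<sqinter>\<^bsub>B\<^esub> f y = f (x \<sqinter>\<^bsub>A\<^esub> y)"
    "\<And>x y. x \<in> carrier A \<Longrightarrow> y \<in> carrier A \<Longrightarrow> f x \<squnion>\<^bsub>B\<^esub> f y = f (x \<squnion>\<^bsub>A\<^esub> y)"
    "\<And>x y. x \<in> carrier A \<Longrightarrow> y \<in> carrier A \<Longrightarrow> f x \<rightharpoonup>\<^bsub>B\<^esub> f y = f (x \<rightharpoonup>\<^bsub>A\<^esub> y)"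
    using f by (auto simp: heyting_hom_def)
  show ?thesis
  proof
    show "closed_under_ops B (carrier B)"
      unfolding B using A.closed f by (rule closed_under_ops_hom_image)
  next
    fix x y z assume "x \<in> carrier B" "y \<in> carrier B" "z \<in> carrier B"
    then obtain a b c where "a \<in> carrier A" "x = f a" "b \<in> carrier A" "y = f b"
      "c \<in> carrier A" "z = f c"
      unfolding B by blast
    thus "(x \<sqinter>\<^bsub>B\<^esub> y) \<sqinter>\<^bsub>B\<^esub> z = x \<sqinter>\<^bsub>B\<^esub> (y \<sqinter>\<^bsub>B\<^esub> z)"
      and "(x \<squnion>\<^bsub>B\<^esub> y) \<squnion>\<^bsub>B\<^esub> z = x \<squnion>\<^bsub>B\<^esub> (y \<squnion>\<^bsub>B\<^esub> z)"
      and "(x \<sqinter>\<^bsub>B\<^esub> y) \<sqinter>\<^bsub>B\<^esub> z = x \<sqinter>\<^bsub>B\<^esub> y \<longleftrightarrow> x \<sqinter>\<^bsub>B\<^esub> (y \<rightharpoonup>\<^bsub>B\<^esub> z) = x"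
      using A.residuation[of a b c] inj
      by (auto simp: f_ops mem A.meet_assoc A.join_assoc inj_on_eq_iff)
  next
    fix x y assume "x \<in> carrier B" "y \<in> carrier B"
    then obtain a b where "a \<in> carrier A" "x = f a" "b \<in> carrier A" "y = f b"
      unfolding B by blast
    thus "x \<sqinter>\<^bsub>B\<^esub> y = y \<sqinter>\<^bsub>B\<^esub> x" and "x \<squnion>\<^bsub>B\<^esub> y = y \<squnion>\<^bsub>B\<^esub> x"
      and "x \<sqinter>\<^bsub>B\<^esub> (x \<squnion>\<^bsub>B\<^esub> y) = x" and "x \<squnion>\<^bsub>B\<^esub> (x \<sqinter>\<^bsub>B\<^esub> y) = x"
      using A.meet_comm[of a b] A.join_comm[of a b] A.meet_absorb[of a b] A.join_absorb[of a b]
      by (simp_all add: f_ops mem)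
  next
    fix x assume "x \<in> carrier B"
    then obtain a where "a \<in> carrier A" "x = f a"
      unfolding B by blast
    thus "\<bottom>\<^bsub>B\<^esub> \<sqinter>\<^bsub>B\<^esub> x = \<bottom>\<^bsub>B\<^esub>" and "x \<sqinter>\<^bsub>B\<^esub> \<top>\<^bsub>B\<^esub> = x"
      by (auto simp: f_ops mem A.bot_least A.top_greatest)
  qed
qed

lemma valid_eq_iso:
  assumes A: "closed_under_ops A (carrier A)" and f: "heyting_hom A B f"
    and bij: "bij_betw f (carrier A) (carrier B)" and st: "valid_eq A s t"
  shows "valid_eq B s t"
  unfolding valid_eq_def
proof (intro allI impI)
  fix w :: "nat \<Rightarrow> _" assume w: "range w \<subseteq> carrier B"
  define v where "v = inv_into (carrier A) f \<circ> w"
  have B: "carrier B = f ` carrier A"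
    using bij by (auto simp: bij_betw_def)
  have v: "range v \<subseteq> carrier A"
    using w by (auto simp: v_def B intro!: inv_into_into)
  have "f (v j) = w j" for j
    using w by (auto simp: v_def B intro!: f_inv_into_f)
  hence "f \<circ> v = w" by auto
  moreover have "hterm_val A v s = hterm_val A v t"
    using st v by (simp add: valid_eq_def)
  ultimately show "hterm_val B w s = hterm_val B w t"
    using hterm_val_hom[OF A f v] by metis
qed

lemma generated_by_card_iso:
  assumes A: "closed_under_ops A (carrier A)" and f: "heyting_hom A B f"
    and bij: "bij_betw f (carrier A) (carrier B)" and gen: "generated_by_card k A"
  shows "generated_by_card k B"
proof -
  have B: "carrier B = f ` carrier A" and inj: "inj_on f (carrier A)"
    using bij by (auto simp: bij_betw_def)
  obtain G where G: "G \<subseteq> carrier A" "finite G" "card G = k"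
    "generated_subalgebra A G = carrier A"
    using gen by (auto simp: generated_by_card_def)
  have "carrier B \<subseteq> S" if S: "subalgebra B S" "f ` G \<subseteq> S" for S
  proof -
    have "subalgebra A {x \<in> carrier A. f x \<in> S}"
      using A f S(1) unfolding subalgebra_def closed_under_ops_def heyting_hom_def by auto
    moreover have "G \<subseteq> {x \<in> carrier A. f x \<in> S}"
      using S G(1) by auto
    ultimately have "carrier A \<subseteq> {x \<in> carrier A. f x \<in> S}"
      unfolding G(4)[symmetric] generated_subalgebra_def by blast
    thus ?thesis unfolding B by blast
  qed
  moreover have "subalgebra B (carrier B)"
    using closed_under_ops_hom_image[OF A f] unfolding subalgebra_def B by simp
  moreover have "f ` G \<subseteq> carrier B" using G(1) B by auto
  ultimately have "generated_subalgebra B (f ` G) = carrier B"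
    unfolding generated_subalgebra_def by blast
  moreover have "card (f ` G) = k"
    using card_image[OF inj_on_subset[OF inj G(1)]] G(3) by simp
  ultimately show ?thesis
    using G(2) \<open>f ` G \<subseteq> carrier B\<close> by (auto simp: generated_by_card_def)
qed

section \<open>The order and its clopen upsets\<close>

lemma Pt_mem_points [simp]: "Pt a i \<in> points k \<longleftrightarrow> a \<le> 2 ^ k"
  by (auto simp: points_def)

lemma PInf_mem_points [simp]: "PInf \<in> points k"
  by (auto simp: points_def)

lemma pt_le_Pt_Pt [simp]:
  "pt_le k (Pt a i) (Pt b j) \<longleftrightarrow> a \<le> 2 ^ k \<and> b \<le> 2 ^ k \<and>
     (a = b \<and> i = j \<or> i = j + 1 \<and> b \<noteq> a + 1 \<or> j + 2 \<le> i)"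
proof -
  have "pt_le k (Pt a i) (Pt b j)" if "a \<le> 2 ^ k" "b \<le> 2 ^ k" "j + 2 \<le> i"
    using pt_le.jump[OF that(1,2), of "i - j" j] that by simp
  thus ?thesis
    by (auto elim: pt_le.cases intro: pt_le.refl pt_le.step[of a k b j, simplified])
qed

lemma pt_le_PInf [simp]: "pt_le k PInf y \<longleftrightarrow> y \<in> points k"
  by (auto simp: points_def elim: pt_le.cases intro: pt_le.refl pt_le.inf)

lemma not_pt_le_Pt_PInf [simp]: "\<not> pt_le k (Pt a i) PInf"
  by (auto elim: pt_le.cases)

lemma pt_le_points: "pt_le k x y \<Longrightarrow> x \<in> points k \<and> y \<in> points k"
  by (cases x; cases y) auto

lemma pt_le_trans: "pt_le k x y \<Longrightarrow> pt_le k y z \<Longrightarrow> pt_le k x z"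
  by (cases x; cases y; cases z) auto

lemma is_upset_up: "is_upset k (up k x)"
  by (auto simp: is_upset_def up_def dest: pt_le_points intro: pt_le_trans)

lemma mem_up_self: "x \<in> points k \<Longrightarrow> x \<in> up k x"
  by (simp add: up_def pt_le.refl)

lemma up_PInf: "up k PInf = points k"
  by (auto simp: up_def)

lemma upset_PInf: "is_upset k U \<Longrightarrow> PInf \<in> U \<Longrightarrow> U = points k"
  by (auto simp: is_upset_def)

lemma finite_levels: "finite {Pt a i |a i. a \<le> 2 ^ k \<and> i \<le> m}"
proof -
  have "{Pt a i |a i. a \<le> 2 ^ k \<and> i \<le> m} = case_prod Pt ` ({..2 ^ k} \<times> {..m})"
    by auto
  thus ?thesis by simp
qed

lemma finite_up: "finite (up k (Pt a i))"
proof (rule finite_subset[OF _ finite_levels])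
  show "up k (Pt a i) \<subseteq> {Pt a i' |a i'. a \<le> 2 ^ k \<and> i' \<le> i}"
    by (auto simp: up_def points_def)
qed

lemma infinite_points: "infinite (points k)"
proof
  assume "finite (points k)"
  hence "finite (Pt 0 ` UNIV)" by (rule rev_finite_subset) auto
  thus False by (auto dest: finite_imageD simp: inj_on_def)
qed

lemma topspace_pt_topology: "topspace (pt_topology k) = points k"
proof -
  have "up k x \<subseteq> points k" for x by (auto simp: up_def)
  thus ?thesis
    by (auto simp: pt_topology_def up_PInf)
qed

lemma clopen_up: "a \<le> 2 ^ k \<Longrightarrow> openin (pt_topology k) (up k (Pt a i))"
  "a \<le> 2 ^ k \<Longrightarrow> closedin (pt_topology k) (up k (Pt a i))"
proof -
  assume a: "a \<le> 2 ^ k"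
  show "openin (pt_topology k) (up k (Pt a i))"
    unfolding pt_topology_def using a by (intro topology_generated_by_Basis) auto
  have "openin (pt_topology k) (points k - up k (Pt a i))"
    unfolding pt_topology_def using a by (intro topology_generated_by_Basis) auto
  thus "closedin (pt_topology k) (up k (Pt a i))"
    by (auto simp: closedin_def topspace_pt_topology up_def)
qed

text \<open>The only basic open sets around \<open>PInf\<close> are the whole space and complements of principal
  upsets of other points, and those upsets are finite.\<close>

lemma open_PInf_cofinite:
  assumes "openin (pt_topology k) U" "PInf \<in> U"
  shows "finite (points k - U)"
proof -
  let ?B = "{up k (Pt l i) |l i. l \<le> 2 ^ k} \<union> {points k - up k (Pt l i) |l i. l \<le> 2 ^ k} \<union>
      {{}, up k PInf}"
  have "generate_topology_on ?B U"
    using assms(1) by (simp add: pt_topology_def openin_topology_generated_by_iff)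
  thus ?thesis using assms(2)
  proof (induction rule: generate_topology_on.induct)
    case (Int U V)
    thus ?case by (simp add: Diff_Int)
  next
    case (UN \<U>)
    then obtain U where "U \<in> \<U>" "PInf \<in> U" "finite (points k - U)" by blast
    thus ?case by (elim finite_subset[rotated]) auto
  next
    case (Basis U)
    have "points k - (points k - up k (Pt l i)) = up k (Pt l i)" for l i
      by (auto simp: up_def)
    moreover have "PInf \<notin> up k (Pt l i)" for l i
      by (simp add: up_def)
    ultimately show ?case using Basis by (auto simp: finite_up up_PInf)
  qed simp
qed

lemma upset_eq_Union_up: "is_upset k U \<Longrightarrow> U = (\<Union>x\<in>U. up k x)"
  by (auto simp: is_upset_def up_def intro: pt_le.refl)

text \<open>An upset containing \<open>PInf\<close> is everything.  Otherwise its complement is an open set around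
  \<open>PInf\<close>, hence cofinite; conversely a finite upset without \<open>PInf\<close> is a finite union of clopen
  principal upsets.  After this characterization the topology is not mentioned again.\<close>

lemma carrier_H: "carrier (H k) = {U. is_upset k U \<and> (finite U \<or> U = points k)}"
proof (intro equalityI subsetI)
  fix U assume "U \<in> carrier (H k)"
  hence U: "closedin (pt_topology k) U" "is_upset k U" by (auto simp: H_def)
  show "U \<in> {U. is_upset k U \<and> (finite U \<or> U = points k)}"
  proof (cases "PInf \<in> U")
    case True
    thus ?thesis using U upset_PInf by auto
  next
    case False
    hence "finite (points k - (points k - U))"
      using U by (intro open_PInf_cofinite) (auto simp: closedin_def topspace_pt_topology)
    moreover have "points k - (points k - U) = U"
      using U by (auto simp: is_upset_def)
    ultimately show ?thesis using U by auto
  qed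
next
  fix U assume "U \<in> {U. is_upset k U \<and> (finite U \<or> U = points k)}"
  hence U: "is_upset k U" and "finite U \<or> U = points k" by auto
  from this(2) show "U \<in> carrier (H k)"
  proof
    assume fin: "finite U"
    hence "PInf \<notin> U" using U upset_PInf infinite_points by blast
    hence *: "openin (pt_topology k) (up k x) \<and> closedin (pt_topology k) (up k x)"
      if "x \<in> U" for x
      using that U clopen_up by (cases x) (auto simp: is_upset_def)
    have "openin (pt_topology k) (\<Union>x\<in>U. up k x)"
      using * by (intro openin_Union) auto
    moreover have "closedin (pt_topology k) (\<Union>x\<in>U. up k x)"
      using * fin by (intro closedin_Union) auto
    ultimately show ?thesis
      using U upset_eq_Union_up[OF U] by (simp add: H_def)
  next
    assume "U = points k"
    thus ?thesis using U by (auto simp: H_def topspace_pt_topology[symmetric])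
  qed
qed

lemma H_simps:
  "U \<sqinter>\<^bsub>H k\<^esub> V = U \<inter> V" "U \<squnion>\<^bsub>H k\<^esub> V = U \<union> V"
  "U \<rightharpoonup>\<^bsub>H k\<^esub> V = points k - down k (U - V)" "\<bottom>\<^bsub>H k\<^esub> = {}" "\<top>\<^bsub>H k\<^esub> = points k"
  by (simp_all add: H_def)

lemma is_upset_imp: "is_upset k (points k - down k W)"
  by (auto simp: is_upset_def down_def dest: pt_le_points intro: pt_le_trans)

lemma imp_finite:
  assumes U: "is_upset k U" and V: "is_upset k V"
    and finV: "finite V \<or> V = points k"
  shows "finite (points k - down k (U - V)) \<or> points k - down k (U - V) = points k"
proof (cases "U - V = {}")
  case True
  show ?thesis unfolding True by (simp add: down_def)
next
  case False
  then obtain x where x: "x \<in> U - V" by blast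
  hence "x \<in> points k" using U by (auto simp: is_upset_def)
  show ?thesis
  proof (cases x)
    case (Pt a i)
    have "points k - down k (U - V) \<subseteq> {Pt b j |b j. b \<le> 2 ^ k \<and> j \<le> i + 2}"
    proof
      fix y assume y: "y \<in> points k - down k (U - V)"
      hence "\<not> pt_le k y x" using x by (auto simp: down_def)
      thus "y \<in> {Pt b j |b j. b \<le> 2 ^ k \<and> j \<le> i + 2}"
        using y \<open>x \<in> points k\<close> Pt by (cases y) auto
    qed
    thus ?thesis using finite_levels finite_subset by blast
  next
    case PInf
    hence "U = points k" using x U upset_PInf by auto
    have "points k - down k (U - V) \<subseteq> V"
      using mem_up_self \<open>U = points k\<close> by (auto simp: down_def intro: pt_le.refl)
    moreover have "finite V" using finV x PInf by auto
    ultimately show ?thesis using finite_subset by blast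
  qed
qed

lemma closed_H: "closed_under_ops (H k) (carrier (H k))"
  unfolding closed_under_ops_def
proof (intro conjI ballI)
  show "\<bottom>\<^bsub>H k\<^esub> \<in> carrier (H k)" "\<top>\<^bsub>H k\<^esub> \<in> carrier (H k)"
    by (auto simp: H_simps carrier_H is_upset_def dest: pt_le_points)
  fix U V assume "U \<in> carrier (H k)" "V \<in> carrier (H k)"
  hence UV: "is_upset k U" "is_upset k V" "finite U \<or> U = points k" "finite V \<or> V = points k"
    by (auto simp: carrier_H)
  show "U \<rightharpoonup>\<^bsub>H k\<^esub> V \<in> carrier (H k)"
    using is_upset_imp imp_finite[OF UV(1,2,4)] by (simp add: H_simps carrier_H)
  have "is_upset k (U \<inter> V)" "is_upset k (U \<union> V)" "U \<subseteq> points k" "V \<subseteq> points k"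
    using UV(1,2) by (auto simp: is_upset_def)
  thus "U \<sqinter>\<^bsub>H k\<^esub> V \<in> carrier (H k)" "U \<squnion>\<^bsub>H k\<^esub> V \<in> carrier (H k)"
    using UV(3,4) by (auto simp: H_simps carrier_H Int_absorb1 Int_absorb2)
qed

lemma heyting_algebra_H: "heyting_algebra (H k)"
proof
  show "closed_under_ops (H k) (carrier (H k))" by (rule closed_H)
next
  fix U V W assume "U \<in> carrier (H k)" "V \<in> carrier (H k)" "W \<in> carrier (H k)"
  hence "is_upset k U" by (auto simp: carrier_H)
  thus "(U \<sqinter>\<^bsub>H k\<^esub> V) \<sqinter>\<^bsub>H k\<^esub> W = U \<sqinter>\<^bsub>H k\<^esub> V \<longleftrightarrow> U \<sqinter>\<^bsub>H k\<^esub> (V \<rightharpoonup>\<^bsub>H k\<^esub> W) = U"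
    unfolding H_simps by (auto simp: is_upset_def down_def) (blast intro: pt_le.refl)+
qed (auto simp: H_simps carrier_H is_upset_def)

section \<open>Bounded quotients leave finitely many terms\<close>

text \<open>Intuitionistic forcing.  Taking the worlds from an initial segment of the natural numbers
  leaves only finitely many models with a given number of worlds.\<close>

primrec kripke_val :: "nat \<Rightarrow> (nat \<times> nat) set \<Rightarrow> (nat \<Rightarrow> nat set) \<Rightarrow> hterm \<Rightarrow> nat set" where
  "kripke_val b R c (Var j) = c j"
| "kripke_val b R c Bot = {}"
| "kripke_val b R c Top = {..<b}"
| "kripke_val b R c (Meet s t) = kripke_val b R c s \<inter> kripke_val b R c t"
| "kripke_val b R c (Join s t) = kripke_val b R c s \<union> kripke_val b R c t"
| "kripke_val b R c (Imp s t) =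
     {p. p < b \<and> (\<forall>q. (p, q) \<in> R \<longrightarrow> q \<in> kripke_val b R c s \<longrightarrow> q \<in> kripke_val b R c t)}"

definition kripke_models :: "nat \<Rightarrow> nat \<Rightarrow> ((nat \<times> nat) set \<times> (nat \<Rightarrow> nat set)) set" where
  "kripke_models k b = Pow ({..<b} \<times> {..<b}) \<times> ({..<k} \<rightarrow>\<^sub>E Pow {..<b})"

lemma finite_kripke_models: "finite (kripke_models k b)"
  unfolding kripke_models_def
  by (intro finite_cartesian_product finite_PiE) auto

lemma kripke_val_subset:
  assumes "(R, c) \<in> kripke_models k b" "t \<in> terms_in k"
  shows "kripke_val b R c t \<subseteq> {..<b}"
  using assms(2)
proof (induction t)
  case (Var j)
  thus ?case using assms(1) by (auto simp: kripke_models_def terms_in_def PiE_iff)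
qed (auto simp: terms_in_def)

text \<open>The kernel of \<open>\<rho>\<close> preserves colours and has the back-and-forth property: \<open>\<rho>\<close> is, up to
  its codomain, a p-morphism onto a coloured frame.\<close>

definition bisimulation_map :: "nat \<Rightarrow> (nat \<Rightarrow> pt set) \<Rightarrow> (pt \<Rightarrow> 'c) \<Rightarrow> bool" where
  "bisimulation_map k U \<rho> \<longleftrightarrow> (\<forall>x\<in>points k. \<forall>y\<in>points k. \<rho> x = \<rho> y \<longrightarrow>
     (\<forall>j<k. x \<in> U j \<longleftrightarrow> y \<in> U j) \<and> \<rho> ` up k x = \<rho> ` up k y)"

lemma kripke_model_of_bisimulation_map:
  fixes \<rho> :: "pt \<Rightarrow> nat"
  assumes \<rho>: "bisimulation_map k U \<rho>" "\<rho> ` points k \<subseteq> {..<b}"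
    and U: "\<And>j. j < k \<Longrightarrow> U j \<subseteq> points k"
  obtains R c where "(R, c) \<in> kripke_models k b"
    "\<And>t. t \<in> terms_in k \<Longrightarrow>
       hterm_val (H k) U t = {x \<in> points k. \<rho> x \<in> kripke_val b R c t}"
proof -
  define R where "R = {(\<rho> x, \<rho> y) |x y. x \<in> points k \<and> y \<in> up k x}"
  define c where "c = (\<lambda>j\<in>{..<k}. \<rho> ` U j)"
  have "(R, c) \<in> kripke_models k b"
    using \<rho>(2) U by (fastforce simp: kripke_models_def R_def c_def up_def)
  moreover have "hterm_val (H k) U t = {x \<in> points k. \<rho> x \<in> kripke_val b R c t}"
    if "t \<in> terms_in k" for t
    using that
  proof (induction t)
    case (Var j)
    hence "j < k" by (simp add: terms_in_def)
    have "x \<in> U j" if "x \<in> points k" "y \<in> U j" "\<rho> x = \<rho> y" for x y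
      using \<rho>(1) that U[OF \<open>j < k\<close>] \<open>j < k\<close> unfolding bisimulation_map_def by blast
    thus ?case using U[OF \<open>j < k\<close>] \<open>j < k\<close> by (auto simp: c_def)
  next
    case (Imp s t)
    hence IH: "hterm_val (H k) U s = {x \<in> points k. \<rho> x \<in> kripke_val b R c s}"
      "hterm_val (H k) U t = {x \<in> points k. \<rho> x \<in> kripke_val b R c t}"
      by (auto simp: terms_in_def)
    have R: "(\<rho> x, q) \<in> R \<longleftrightarrow> q \<in> \<rho> ` up k x" if "x \<in> points k" for x q
    proof
      assume "(\<rho> x, q) \<in> R"
      then obtain x' y where "\<rho> x' = \<rho> x" "q = \<rho> y" "x' \<in> points k" "y \<in> up k x'"
        by (auto simp: R_def)
      moreover from this have "\<rho> ` up k x' = \<rho> ` up k x"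
        using \<rho>(1) that unfolding bisimulation_map_def by blast
      ultimately show "q \<in> \<rho> ` up k x" by blast
    qed (use that in \<open>auto simp: R_def\<close>)
    have "x \<in> hterm_val (H k) U (Imp s t) \<longleftrightarrow> \<rho> x \<in> kripke_val b R c (Imp s t)"
      if "x \<in> points k" for x
      using \<rho>(2) that by (auto simp: IH H_simps R down_def up_def)
    moreover have "hterm_val (H k) U (Imp s t) \<subseteq> points k"
      by (auto simp: H_simps)
    ultimately show ?case by blast
  qed (use \<rho>(2) in \<open>auto simp: terms_in_def H_simps\<close>)
  ultimately show thesis by (rule that)
qed

text \<open>By the assumed bound each valuation factors through one of the finitely many models with
  worlds \<open>{..<b}\<close>.  So a term is determined, up to equations valid in \<open>H k\<close>, by the function
  \<open>\<phi> t\<close> listing its values in all these models, and only finitely many such functions exist.\<close>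

lemma finitely_many_terms:
  assumes quot: "\<And>U. (\<And>j. j < k \<Longrightarrow> U j \<in> carrier (H k)) \<Longrightarrow>
    \<exists>\<rho> :: pt \<Rightarrow> pt. bisimulation_map k U \<rho> \<and> finite (\<rho> ` points k) \<and> card (\<rho> ` points k) \<le> b"
  obtains T where "finite T" "T \<subseteq> terms_in k"
    "\<And>t. t \<in> terms_in k \<Longrightarrow> \<exists>t'\<in>T. valid_eq (H k) t t'"
proof -
  define \<phi> where "\<phi> t = (\<lambda>(R, c) \<in> kripke_models k b. kripke_val b R c t)" for t
  have "\<phi> ` terms_in k \<subseteq> kripke_models k b \<rightarrow>\<^sub>E Pow {..<b}"
  proof (intro image_subsetI PiE_I)
    fix t m assume t: "t \<in> terms_in k" and m: "m \<in> kripke_models k b"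
    show "\<phi> t m \<in> Pow {..<b}"
      using kripke_val_subset[OF _ t] m by (cases m) (auto simp: \<phi>_def)
  qed (simp add: \<phi>_def)
  hence "finite (\<phi> ` terms_in k)"
    by (rule finite_subset) (auto intro!: finite_PiE finite_kripke_models)
  then obtain T where T: "T \<subseteq> terms_in k" "finite T" "\<phi> ` terms_in k = \<phi> ` T"
    by (meson finite_subset_image order_refl)
  have eq: "valid_eq (H k) s t" if st: "s \<in> terms_in k" "t \<in> terms_in k" "\<phi> s = \<phi> t" for s t
    unfolding valid_eq_def
  proof (intro allI impI)
    fix U :: "nat \<Rightarrow> pt set" assume U: "range U \<subseteq> carrier (H k)"
    then obtain \<rho> :: "pt \<Rightarrow> pt" where \<rho>: "bisimulation_map k U \<rho>" "finite (\<rho> ` points k)"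
      "card (\<rho> ` points k) \<le> b"
      using quot[of U] by blast
    obtain e :: "pt \<Rightarrow> nat" where e: "inj_on e (\<rho> ` points k)" "e ` \<rho> ` points k \<subseteq> {..<b}"
      using card_le_inj[OF \<rho>(2), of "{..<b}"] \<rho>(3) by auto
    have "bisimulation_map k U (e \<circ> \<rho>)"
      unfolding bisimulation_map_def
    proof (intro ballI impI)
      fix x y assume xy: "x \<in> points k" "y \<in> points k" "(e \<circ> \<rho>) x = (e \<circ> \<rho>) y"
      hence "\<rho> x = \<rho> y" using e(1) by (auto dest: inj_onD)
      with \<rho>(1) xy have "(\<forall>j<k. x \<in> U j \<longleftrightarrow> y \<in> U j) \<and> \<rho> ` up k x = \<rho> ` up k y"
        unfolding bisimulation_map_def by blast
      thus "(\<forall>j<k. x \<in> U j \<longleftrightarrow> y \<in> U j) \<and> (e \<circ> \<rho>) ` up k x = (e \<circ> \<rho>) ` up k y"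
        unfolding image_comp[symmetric] by simp
    qed
    moreover have "(e \<circ> \<rho>) ` points k \<subseteq> {..<b}" using e(2) by (simp add: image_comp)
    moreover have "U j \<subseteq> points k" for j
      using U by (auto simp: carrier_H is_upset_def)
    ultimately obtain R c where Rc: "(R, c) \<in> kripke_models k b"
      "\<And>t. t \<in> terms_in k \<Longrightarrow>
         hterm_val (H k) U t = {x \<in> points k. (e \<circ> \<rho>) x \<in> kripke_val b R c t}"
      by (rule kripke_model_of_bisimulation_map[of k U "e \<circ> \<rho>" b]) (erule that, simp)
    have "\<phi> s (R, c) = \<phi> t (R, c)" using st by simp
    hence "kripke_val b R c s = kripke_val b R c t" using Rc(1) by (simp add: \<phi>_def)
    thus "hterm_val (H k) U s = hterm_val (H k) U t" using Rc(2) st by simp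
  qed
  show thesis
  proof (rule that[OF T(2,1)])
    fix t assume "t \<in> terms_in k"
    moreover from this obtain t' where "t' \<in> T" "\<phi> t = \<phi> t'" using T(3) by blast
    ultimately show "\<exists>t'\<in>T. valid_eq (H k) t t'" using eq T(1) by blast
  qed
qed

section \<open>Collapsing the levels under a colouring\<close>

locale colouring =
  fixes k :: nat and U :: "nat \<Rightarrow> pt set"
  assumes U: "j < k \<Longrightarrow> U j \<in> carrier (H k)"
begin

lemma U_upward: "j < k \<Longrightarrow> x \<in> U j \<Longrightarrow> pt_le k x y \<Longrightarrow> y \<in> U j"
  using U[of j] by (auto simp: carrier_H is_upset_def)

definition col :: "nat \<Rightarrow> nat \<Rightarrow> nat set" where
  "col i a = {j. j < k \<and> Pt a i \<in> U j}"

text \<open>Column \<open>a\<close> is blocked at level \<open>i + 1\<close> if the point \<open>Pt (a + 1) i\<close> missed by \<open>Pt a (i + 1)\<close>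
  is the only one of its class: another point of level \<open>i\<close> is in the same class if both columns
  are unblocked there and have the same colour.  A blocked point counts as a class of its own,
  even where a coarser bisimulation would be possible.  The condition in the recursive
  clause is unfolded because the notions of twins and of lone points below refer to
  \<open>blocked\<close>.\<close>

primrec blocked :: "nat \<Rightarrow> nat set" where
  "blocked 0 = {}"
| "blocked (Suc i) = {a. a + 1 \<le> 2 ^ k \<and> (\<forall>b \<le> 2 ^ k. b \<noteq> a + 1 \<longrightarrow>
     \<not> (a + 1 \<notin> blocked i \<and> b \<notin> blocked i \<and> col i (a + 1) = col i b))}"

definition twins :: "nat \<Rightarrow> nat \<Rightarrow> nat \<Rightarrow> bool" where
  "twins i a b \<longleftrightarrow> a \<notin> blocked i \<and> b \<notin> blocked i \<and> col i a = col i b"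

definition lone :: "nat \<Rightarrow> nat set" where
  "lone i = {a. a \<le> 2 ^ k \<and> (\<forall>b \<le> 2 ^ k. b \<noteq> a \<longrightarrow> \<not> twins i a b)}"

definition free :: "nat \<Rightarrow> nat set" where
  "free i = {..2 ^ k} - blocked i"

lemma blocked_Suc: "blocked (Suc i) = {a. a + 1 \<in> lone i}"
  by (auto simp: lone_def twins_def)

declare blocked.simps(2) [simp del]

lemma blocked_subset: "blocked i \<subseteq> {..2 ^ k}"
  by (cases i) (auto simp: blocked_Suc lone_def)

lemma finite_free [simp]: "finite (free i)" and finite_blocked [simp]: "finite (blocked i)"
  and finite_lone [simp]: "finite (lone i)"
  using finite_subset[OF blocked_subset] by (auto simp: free_def lone_def)

lemma card_blocked_free: "card (blocked i) + card (free i) = 2 ^ k + 1"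
  using card_Diff_subset[OF finite_blocked blocked_subset, of i]
    card_mono[OF finite_atMost blocked_subset, of i] by (simp add: free_def)

subsection \<open>The number of classes on a level\<close>

definition active :: "nat \<Rightarrow> nat \<Rightarrow> bool" where
  "active j i \<longleftrightarrow> (\<exists>a \<le> 2 ^ k. Pt a i \<in> U j) \<and> (\<exists>b \<le> 2 ^ k. Pt b i \<notin> U j)"

definition used :: "nat \<Rightarrow> nat set" where
  "used i = {j. j < k \<and> (\<exists>i'\<le>i. active j i')}"

lemma finite_used [simp]: "finite (used i)"
  by (simp add: used_def)

lemma card_used: "card (used i) \<le> k"
  using card_mono[of "{..<k}" "used i"] by (auto simp: used_def)

text \<open>A generator that distinguishes points at some level and is still nonempty at a deeper one
  is the upset of a single point \<open>Pt a i'\<close> with \<open>i' = i + 1\<close>: it contains all of level \<open>i\<close>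
  but the point \<open>Pt (a + 1) i\<close>, whose colour is thereby unique.  So \<open>a\<close> is blocked, and the
  generator cannot help to distinguish unblocked points a second time.\<close>

lemma active_above_blocked:
  assumes j: "j < k" and act: "active j i" "i < i'" and a: "a \<le> 2 ^ k" "Pt a i' \<in> U j"
  shows "a \<in> blocked i'"
proof -
  obtain b where b: "b \<le> 2 ^ k" "Pt b i \<notin> U j"
    using act by (auto simp: active_def)
  hence "\<not> pt_le k (Pt a i') (Pt b i)" using U_upward[OF j a(2)] by blast
  hence i': "i' = Suc i" and ba: "b = a + 1" using a b act by auto
  have "Pt b' i \<in> U j" if "b' \<le> 2 ^ k" "b' \<noteq> a + 1" for b'
    using U_upward[OF j a(2)] a that i' by auto
  hence "col i b \<noteq> col i b'" if "b' \<le> 2 ^ k" "b' \<noteq> b" for b'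
    using that ba b(2) j by (auto simp: col_def)
  thus ?thesis
    using b(1) by (auto simp: i' blocked_Suc lone_def twins_def ba)
qed

lemma card_colours:
  assumes "finite D"
    and same: "\<And>j a b. j < k \<Longrightarrow> j \<notin> D \<Longrightarrow> a \<in> free i \<Longrightarrow> b \<in> free i \<Longrightarrow>
      Pt a i \<in> U j \<Longrightarrow> Pt b i \<in> U j"
  shows "card (col i ` free i) \<le> 2 ^ card D"
proof -
  have "inj_on (\<lambda>X. X \<inter> D) (col i ` free i)"
  proof (rule inj_onI; clarify)
    fix a b assume ab: "a \<in> free i" "b \<in> free i" and eq: "col i a \<inter> D = col i b \<inter> D"
    have "j \<in> col i a \<longleftrightarrow> j \<in> col i b" for j
      using eq same[OF _ _ ab] same[OF _ _ ab(2,1)] by (cases "j \<in> D") (auto simp: col_def)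
    thus "col i a = col i b" by blast
  qed
  hence "card (col i ` free i) \<le> card (Pow D)"
    by (rule card_inj_on_le) (auto simp: assms)
  thus ?thesis by (simp add: card_Pow assms)
qed

text \<open>There are more columns than classes, so some colour is shared by two unblocked columns;
  that class contributes no lone point.\<close>

lemma card_lone:
  assumes "card (blocked i) + card (col i ` free i) \<le> 2 ^ k"
  shows "card (lone i) + 1 \<le> card (blocked i) + card (col i ` free i)"
proof -
  have "card (col i ` free i) < card (free i)"
    using assms card_blocked_free[of i] by linarith
  hence "\<not> inj_on (col i) (free i)" using card_image by force
  then obtain a b where ab: "a \<in> free i" "b \<in> free i" "a \<noteq> b" "col i a = col i b"
    by (auto simp: inj_on_def)
  define Y where "Y = {x \<in> free i. \<forall>y\<in>free i. y \<noteq> x \<longrightarrow> col i x \<noteq> col i y}"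
  have "inj_on (col i) Y" by (auto simp: Y_def inj_on_def)
  moreover have "col i x \<noteq> col i a" if "x \<in> Y" for x
    using that ab unfolding Y_def by (cases "x = a") auto
  hence "col i ` Y \<subseteq> col i ` free i - {col i a}"
    by (auto simp: Y_def)
  ultimately have "card Y \<le> card (col i ` free i - {col i a})"
    by (intro card_inj_on_le) auto
  moreover have "card (col i ` free i) > 0" using ab by (auto simp: card_gt_0_iff)
  ultimately have "card Y + 1 \<le> card (col i ` free i)"
    using ab by (simp add: card_Diff_singleton)
  moreover have "lone i \<subseteq> blocked i \<union> Y"
    by (auto simp: lone_def Y_def free_def twins_def)
  hence "card (lone i) \<le> card (blocked i) + card Y"
    using card_mono[of "blocked i \<union> Y" "lone i"] card_Un_le[of "blocked i" Y]
    by (simp add: Y_def)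
  ultimately show ?thesis by linarith
qed

lemma two_powers_le: "2 ^ x + 2 ^ y \<le> 2 ^ (x + y) + (1 :: nat)"
proof -
  have "(2 ^ x - 1) * (2 ^ y - 1) \<ge> (0 :: int)" by simp
  hence "(2 :: int) ^ x + 2 ^ y \<le> 2 ^ (x + y) + 1" by (simp add: algebra_simps power_add)
  thus ?thesis by (metis (mono_tags) of_nat_1 of_nat_add of_nat_le_iff of_nat_numeral of_nat_power)
qed

text \<open>The points at level \<open>i + 1\<close> fall into at most \<open>2 ^ x - 1\<close> blocked ones, one for each lone
  point of level \<open>i\<close>, where \<open>x = card (used i)\<close>, and unblocked ones.  By \<open>active_above_blocked\<close> the
  unblocked ones are separated only by generators active for the first time, at most \<open>2 ^ y\<close> ways
  if there are \<open>y\<close> of these.  Then \<open>2 ^ x - 1 + 2 ^ y \<le> 2 ^ (x + y)\<close> closes the induction.\<close>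

lemma card_classes: "card (blocked i) + card (col i ` free i) \<le> 2 ^ card (used i)"
proof (induction i)
  case 0
  have "card (col 0 ` free 0) \<le> 2 ^ card (used 0)"
    by (rule card_colours) (auto simp: used_def active_def free_def)
  thus ?case by simp
next
  case (Suc i)
  have "card (blocked i) + card (col i ` free i) \<le> 2 ^ k"
    using Suc card_used[of i] by (meson le_trans one_le_numeral power_increasing)
  hence "card (lone i) + 1 \<le> 2 ^ card (used i)"
    using Suc card_lone[of i] by linarith
  moreover have "card (blocked (Suc i)) \<le> card (lone i)"
    by (rule card_inj_on_le[of Suc]) (auto simp: blocked_Suc)
  moreover define D where "D = used (Suc i) - used i"
  have "card (col (Suc i) ` free (Suc i)) \<le> 2 ^ card D"
  proof (rule card_colours)
    fix j a b
    assume j: "j < k" "j \<notin> D" and ab: "a \<in> free (Suc i)" "b \<in> free (Suc i)"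
      and a: "Pt a (Suc i) \<in> U j"
    have le: "a \<le> 2 ^ k" "b \<le> 2 ^ k" using ab by (auto simp: free_def)
    show "Pt b (Suc i) \<in> U j"
    proof (rule ccontr)
      assume "Pt b (Suc i) \<notin> U j"
      hence "active j (Suc i)" using a le by (auto simp: active_def)
      hence "j \<in> used i" using j by (auto simp: D_def used_def)
      then obtain i' where "active j i'" "i' < Suc i" by (auto simp: used_def)
      thus False using active_above_blocked[OF j(1) _ _ le(1) a] ab(1) by (auto simp: free_def)
    qed
  qed (simp add: D_def)
  moreover have "used i \<subseteq> used (Suc i)" by (auto simp: used_def intro: le_SucI)
  hence "card (used (Suc i)) = card (used i) + card D"
    by (simp add: D_def card_Diff_subset card_mono)
  ultimately show ?case
    using two_powers_le[of "card (used i)" "card D"] by simp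
qed

lemma ex_free: "\<exists>b. b \<in> free i \<and> b \<noteq> a"
proof -
  have le: "card (blocked i) + card (col i ` free i) \<le> 2 ^ k"
    using card_classes[of i] card_used[of i] by (meson le_trans one_le_numeral power_increasing)
  hence "free i \<noteq> {}" using card_blocked_free[of i] by auto
  hence "card (col i ` free i) > 0" by (auto simp: card_gt_0_iff)
  hence "card (free i) > 1" using le card_blocked_free[of i] by linarith
  hence "\<not> free i \<subseteq> {a}" using card_mono[of "{a}" "free i"] by auto
  thus ?thesis by auto
qed

subsection \<open>Levels of constant colour\<close>

definition uniform :: "nat \<Rightarrow> nat \<Rightarrow> bool" where
  "uniform i i' \<longleftrightarrow> (\<forall>p\<in>{i..i'}. \<forall>q\<in>{i..i'}. \<forall>a\<le>2 ^ k. \<forall>b\<le>2 ^ k. col p a = col q b)"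

lemma uniform_mono: "uniform i i' \<Longrightarrow> i \<le> p \<Longrightarrow> q \<le> i' \<Longrightarrow> uniform p q"
  unfolding uniform_def by (meson atLeastAtMost_iff le_trans)

text \<open>Where colours are constant, the unblocked columns (at least two) are all twins, so only
  blocked columns are lone.\<close>

lemma blocked_uniform_step:
  assumes "uniform i i" "a \<in> blocked (Suc i)"
  shows "a + 1 \<in> blocked i"
proof (rule ccontr)
  assume "a + 1 \<notin> blocked i"
  moreover obtain b where b: "b \<in> free i" "b \<noteq> a + 1" using ex_free by blast
  moreover have lone: "a + 1 \<in> lone i" using assms(2) by (simp add: blocked_Suc)
  moreover have "col i (a + 1) = col i b"
    using assms(1) b(1) lone unfolding uniform_def free_def lone_def by simp
  ultimately show False
    unfolding lone_def twins_def free_def by blast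
qed

lemma blocked_uniform:
  assumes "uniform i (i + s)" "a \<in> blocked (i + s)"
  shows "a + s \<in> blocked i"
  using assms
proof (induction s arbitrary: a)
  case (Suc s)
  have "a + 1 \<in> blocked (i + s)"
    using Suc.prems by (intro blocked_uniform_step uniform_mono[OF Suc.prems(1)]) auto
  moreover have "uniform i (i + s)" using Suc.prems(1) by (rule uniform_mono) auto
  ultimately show ?case using Suc.IH[of "a + 1"] by simp
qed simp

text \<open>The window length: blocked columns shift to the left by one at each level of constant
  colour and lie in \<open>{..2 ^ k}\<close>, so after \<open>2 ^ k + 1\<close> steps none is left.  One more step makes this true of the
  preceding level too, as needed to identify the two levels.\<close>

definition dull :: "nat \<Rightarrow> bool" where
  "dull i \<longleftrightarrow> 2 ^ k + 2 \<le> i \<and> uniform (i - (2 ^ k + 2)) i"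

lemma dull_Suc:
  assumes "dull (Suc i)"
  shows "blocked (Suc i) = {}" "blocked i = {}" "uniform i (Suc i)" "i > 0"
proof -
  define m where "m = Suc i - (2 ^ k + 2)"
  have i: "i = m + (2 ^ k + 1)"
    using assms unfolding dull_def m_def by linarith
  have uni: "uniform m (Suc i)"
    using assms unfolding dull_def m_def by blast
  have empty: "blocked p = {}" if "m + 2 ^ k < p" "p \<le> Suc i" for p
  proof -
    have "uniform m (m + (p - m))" using uni by (rule uniform_mono) (use that in auto)
    hence "a + (p - m) \<in> blocked m" if "a \<in> blocked p" for a
      using blocked_uniform[of m "p - m" a] that \<open>m + 2 ^ k < p\<close> by simp
    thus ?thesis using blocked_subset[of m] \<open>m + 2 ^ k < p\<close> by fastforce
  qed
  show "blocked (Suc i) = {}" "blocked i = {}" using i by (auto intro!: empty)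
  show "uniform i (Suc i)" using uni by (rule uniform_mono) (use i in auto)
  show "i > 0" using i by simp
qed

definition rep :: "nat \<Rightarrow> nat \<Rightarrow> nat" where
  "rep i a = (if a \<in> blocked i then a else (LEAST b. b \<le> 2 ^ k \<and> twins i a b))"

lemma rep:
  assumes "a \<le> 2 ^ k"
  shows "rep i a \<le> 2 ^ k" "rep i a = a \<or> twins i a (rep i a)"
proof -
  have "rep i a \<le> 2 ^ k \<and> (rep i a = a \<or> twins i a (rep i a))"
  proof (cases "a \<in> blocked i")
    case False
    hence "a \<le> 2 ^ k \<and> twins i a a" using assms by (simp add: twins_def)
    from LeastI[of "\<lambda>b. b \<le> 2 ^ k \<and> twins i a b", OF this] False show ?thesis
      by (simp add: rep_def)
  qed (use assms in \<open>simp add: rep_def\<close>)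
  thus "rep i a \<le> 2 ^ k" "rep i a = a \<or> twins i a (rep i a)" by auto
qed

lemma rep_twins: "twins i a b \<Longrightarrow> rep i a = rep i b"
  by (simp add: rep_def twins_def)

text \<open>The class representative of \<open>Pt a i\<close>.  All points of a dull level are equivalent to all points of
  the level before, hence to the one in column \<open>0\<close>.\<close>

primrec canon :: "nat \<Rightarrow> nat \<Rightarrow> pt" where
  "canon 0 a = Pt (rep 0 a) 0"
| "canon (Suc i) a = (if dull (Suc i) then canon i 0 else Pt (rep (Suc i) a) (Suc i))"

lemma canon_twins: "twins i a b \<Longrightarrow> canon i a = canon i b"
  by (cases i) (auto dest: rep_twins)

lemma canon_dull:
  assumes "dull (Suc i)" "b \<le> 2 ^ k"
  shows "canon (Suc i) a = canon i b"
proof -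
  have "twins i 0 b"
    using dull_Suc[OF assms(1)] assms(2) unfolding twins_def uniform_def by simp
  thus ?thesis using canon_twins assms(1) by simp
qed

lemma canon_colour:
  assumes "j < k"
  shows "a \<le> 2 ^ k \<Longrightarrow> canon i a \<in> U j \<longleftrightarrow> Pt a i \<in> U j"
proof (induction i arbitrary: a)
  case 0
  thus ?case using rep(2)[of a 0] assms by (auto simp: twins_def col_def)
next
  case (Suc i)
  show ?case
  proof (cases "dull (Suc i)")
    case True
    hence "col i 0 = col (Suc i) a"
      using dull_Suc(3)[OF True] Suc.prems unfolding uniform_def by simp
    thus ?thesis using Suc.IH[of 0] True assms by (auto simp: col_def)
  next
    case False
    thus ?thesis using rep(2)[OF Suc.prems, of "Suc i"] assms by (auto simp: twins_def col_def)
  qed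
qed

subsection \<open>The number of levels that remain\<close>

text \<open>The places where generator \<open>j\<close> interrupts a stretch of constant colour.\<close>

definition mixed :: "nat \<Rightarrow> nat set" where
  "mixed j = {i. (\<exists>p\<in>{i, Suc i}. \<exists>a\<le>2 ^ k. Pt a p \<in> U j) \<and> (\<exists>q\<in>{i, Suc i}. \<exists>b\<le>2 ^ k. Pt b q \<notin> U j)}"

text \<open>A point of level \<open>p\<close> lies below all points of level at most \<open>p - 2\<close>, so a generator that reaches level
  \<open>i'\<close> contains everything on the levels \<open>i\<close> and \<open>i + 1\<close> once \<open>i' \<ge> i + 3\<close>.\<close>

lemma mixed_near:
  assumes "j < k" "i \<in> mixed j" "i' \<in> mixed j"
  shows "i' \<le> i + 2"
proof (rule ccontr)
  assume "\<not> i' \<le> i + 2"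
  moreover obtain a p where "a \<le> 2 ^ k" "p \<in> {i', Suc i'}" "Pt a p \<in> U j"
    using assms(3) unfolding mixed_def by blast
  moreover obtain b q where "b \<le> 2 ^ k" "q \<in> {i, Suc i}" "Pt b q \<notin> U j"
    using assms(2) unfolding mixed_def by blast
  ultimately show False
    using U_upward[OF assms(1), of "Pt a p" "Pt b q"] by auto
qed

lemma card_mixed:
  assumes "j < k"
  shows "finite (mixed j)" "card (mixed j) \<le> 3"
proof -
  have "\<exists>m. mixed j \<subseteq> {m..m + 2}"
  proof (cases "mixed j = {}")
    case False
    define m where "m = (LEAST i. i \<in> mixed j)"
    have "m \<in> mixed j" unfolding m_def using False by (auto intro: LeastI)
    moreover have "m \<le> i" if "i \<in> mixed j" for i
      unfolding m_def using that by (rule Least_le)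
    ultimately show ?thesis using mixed_near[OF assms] by (intro exI[of _ m]) auto
  qed auto
  then obtain m where "mixed j \<subseteq> {m..m + 2}" by blast
  with card_mono[OF _ this] finite_subset[OF this]
  show "finite (mixed j)" "card (mixed j) \<le> 3" by auto
qed

lemma uniform_chain:
  assumes "i < i'" "\<And>p. i \<le> p \<Longrightarrow> p < i' \<Longrightarrow> uniform p (Suc p)"
  shows "uniform i i'"
proof -
  have *: "col (i + d) a = col i 0" if "i + d \<le> i'" "a \<le> 2 ^ k" for d a
    using that
  proof (induction d arbitrary: a)
    case 0
    thus ?case using assms(2)[of i] assms(1) unfolding uniform_def by simp
  next
    case (Suc d)
    hence "uniform (i + d) (Suc (i + d))" using assms(2)[of "i + d"] by simp
    hence "col (i + Suc d) a = col (i + d) 0"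
      using Suc.prems unfolding uniform_def by simp
    thus ?case using Suc by simp
  qed
  have "col p a = col i 0" if "p \<in> {i..i'}" "a \<le> 2 ^ k" for p a
    using *[of "p - i" a] that by simp
  thus ?thesis unfolding uniform_def by metis
qed

lemma not_uniform_mixed:
  assumes "\<not> uniform p (Suc p)"
  shows "\<exists>j<k. p \<in> mixed j"
proof -
  obtain x y a b where xy: "x \<in> {p, Suc p}" "y \<in> {p, Suc p}" "a \<le> 2 ^ k" "b \<le> 2 ^ k"
    "col x a \<noteq> col y b"
  proof -
    have "{p..Suc p} = {p, Suc p}" by auto
    thus thesis using assms that unfolding uniform_def by blast
  qed
  then obtain j where "j < k" "Pt a x \<in> U j \<longleftrightarrow> Pt b y \<notin> U j"
    unfolding col_def by blast
  with xy show ?thesis unfolding mixed_def by blast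
qed

lemma not_dull_subset:
  "{i. \<not> dull i} \<subseteq> {..<2 ^ k + 2} \<union> (\<Union>j\<in>{..<k}. \<Union>p\<in>mixed j. {p<..p + (2 ^ k + 2)})"
proof
  fix i assume i: "i \<in> {i. \<not> dull i}"
  show "i \<in> {..<2 ^ k + 2} \<union> (\<Union>j\<in>{..<k}. \<Union>p\<in>mixed j. {p<..p + (2 ^ k + 2)})"
  proof (cases "2 ^ k + 2 \<le> i")
    case True
    hence "\<not> uniform (i - (2 ^ k + 2)) i" using i by (simp add: dull_def)
    hence "\<exists>p. i - (2 ^ k + 2) \<le> p \<and> p < i \<and> \<not> uniform p (Suc p)"
      using uniform_chain[of "i - (2 ^ k + 2)" i] True by fastforce
    then obtain p where p: "i - (2 ^ k + 2) \<le> p" "p < i" "\<not> uniform p (Suc p)" by blast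
    then obtain j where "j < k" "p \<in> mixed j" using not_uniform_mixed by blast
    moreover have "i \<in> {p<..p + (2 ^ k + 2)}" using p by auto
    ultimately show ?thesis by blast
  qed auto
qed

lemma finite_not_dull: "finite {i. \<not> dull i}"
  by (rule finite_subset[OF not_dull_subset]) (auto simp: card_mixed)

lemma card_not_dull: "card {i. \<not> dull i} \<le> (2 ^ k + 2) + k * (3 * (2 ^ k + 2))"
proof -
  let ?W = "2 ^ k + 2 :: nat"
  have "card (\<Union>p\<in>mixed j. {p<..p + ?W}) \<le> 3 * ?W" if "j < k" for j
  proof -
    have "card (\<Union>p\<in>mixed j. {p<..p + ?W}) \<le> (\<Sum>p\<in>mixed j. card {p<..p + ?W})"
      by (rule card_UN_le) (use that card_mixed in auto)
    also have "\<dots> = card (mixed j) * ?W" by simp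
    also have "\<dots> \<le> 3 * ?W" using card_mixed(2)[OF that] by (rule mult_right_mono) simp
    finally show ?thesis .
  qed
  hence "(\<Sum>j<k. card (\<Union>p\<in>mixed j. {p<..p + ?W})) \<le> (\<Sum>j<k. 3 * ?W)"
    by (intro sum_mono) auto
  moreover have "card (\<Union>j\<in>{..<k}. \<Union>p\<in>mixed j. {p<..p + ?W})
      \<le> (\<Sum>j<k. card (\<Union>p\<in>mixed j. {p<..p + ?W}))"
    by (rule card_UN_le) simp
  moreover have "card {i. \<not> dull i}
      \<le> card ({..<?W} \<union> (\<Union>j\<in>{..<k}. \<Union>p\<in>mixed j. {p<..p + ?W}))"
    by (rule card_mono[OF _ not_dull_subset]) (auto simp: card_mixed)
  moreover have "\<dots> \<le> card {..<?W} + card (\<Union>j\<in>{..<k}. \<Union>p\<in>mixed j. {p<..p + ?W})"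
    by (rule card_Un_le)
  ultimately show ?thesis by simp
qed

subsection \<open>The quotient map\<close>

definition bottom :: nat where
  "bottom = (LEAST m. \<forall>i\<ge>m. dull i)"

lemma dull_bottom: "bottom \<le> i \<Longrightarrow> dull i"
proof -
  obtain m where "\<forall>i\<in>{i. \<not> dull i}. i < m"
    using finite_not_dull by (auto simp: finite_nat_set_iff_bounded)
  hence "\<forall>i\<ge>m. dull i" by (metis linorder_not_less mem_Collect_eq)
  hence "\<forall>i\<ge>bottom. dull i" unfolding bottom_def by (rule LeastI)
  thus "bottom \<le> i \<Longrightarrow> dull i" by blast
qed

lemma canon_bottom: "bottom \<le> i \<Longrightarrow> canon i a = canon bottom 0"
proof (induction i arbitrary: a rule: dec_induct)
  case base
  have "bottom > 0" using dull_bottom[of bottom] by (simp add: dull_def)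
  then obtain m where "bottom = Suc m" using gr0_implies_Suc by blast
  thus ?case using dull_bottom[of bottom] by simp
next
  case (step i)
  thus ?case using dull_bottom[of "Suc i"] by simp
qed

primrec collapse :: "pt \<Rightarrow> pt" where
  "collapse (Pt a i) = canon i a"
| "collapse PInf = canon bottom 0"

text \<open>Up to the quotient, an unblocked point sees all preceding levels completely: in place of the
  missed point it sees a twin of it.\<close>

lemma collapse_up_free:
  assumes a: "a \<in> free i"
  shows "collapse ` up k (Pt a i) = insert (canon i a) {canon p b |p b. p < i \<and> b \<le> 2 ^ k}"
    (is "?L = ?R")
proof
  show "?L \<subseteq> ?R"
  proof
    fix z assume "z \<in> ?L"
    then obtain y where y: "y \<in> up k (Pt a i)" "z = collapse y" by blast
    then obtain b p where "y = Pt b p" by (cases y) (auto simp: up_def)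
    hence "b = a \<and> p = i \<or> p < i \<and> b \<le> 2 ^ k" using y(1) by (auto simp: up_def)
    thus "z \<in> ?R" using y(2) \<open>y = Pt b p\<close> by auto
  qed
  have a_le: "a \<le> 2 ^ k" using a by (simp add: free_def)
  have "canon p b \<in> ?L" if p: "p < i" and b: "b \<le> 2 ^ k" for p b
  proof (cases "pt_le k (Pt a i) (Pt b p)")
    case True
    hence "Pt b p \<in> up k (Pt a i)" using b by (simp add: up_def)
    thus ?thesis by force
  next
    case False
    hence i: "i = Suc p" "b = a + 1" using p b a_le by auto
    hence "b \<notin> lone p" using a by (auto simp: free_def blocked_Suc)
    then obtain b' where b': "b' \<le> 2 ^ k" "b' \<noteq> b" "twins p b b'"
      using b by (auto simp: lone_def)
    hence "Pt b' p \<in> up k (Pt a i)" using i a_le by (simp add: up_def)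
    thus ?thesis using canon_twins[OF b'(3)] by force
  qed
  moreover have "canon i a \<in> ?L"
    using mem_up_self[of "Pt a i" k] a_le by force
  ultimately show "?R \<subseteq> ?L" by blast
qed

text \<open>Replacing a point by its representative does not change what it sees.  For a dull level
  \<open>i + 1\<close> there are no blocked points on the levels \<open>i\<close> and \<open>i + 1\<close>, and level \<open>i\<close> is a single
  class, so the extra level seen from \<open>i + 1\<close> adds nothing.\<close>

lemma collapse_up_canon:
  "a \<le> 2 ^ k \<Longrightarrow> collapse ` up k (canon i a) = collapse ` up k (Pt a i)"
proof (induction i arbitrary: a)
  have rep_view: "collapse ` up k (Pt (rep i a) i) = collapse ` up k (Pt a i)"
    if "a \<le> 2 ^ k" for a i
  proof (cases "rep i a = a")
    case False
    hence tw: "twins i a (rep i a)" using rep(2)[OF that] by blast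
    hence "a \<in> free i" "rep i a \<in> free i"
      using rep(1)[OF that] that by (auto simp: twins_def free_def)
    thus ?thesis using canon_twins[OF tw] by (simp add: collapse_up_free)
  qed simp
  {
    case 0
    thus ?case using rep_view by simp
  next
    case (Suc i)
    show ?case
    proof (cases "dull (Suc i)")
      case True
      have "a \<in> free (Suc i)" "0 \<in> free i"
        using dull_Suc(1,2)[OF True] Suc.prems by (auto simp: free_def)
      moreover have "canon i b = canon i 0" if "b \<le> 2 ^ k" for b
        using canon_dull[OF True that] canon_dull[OF True, of 0] by simp
      hence "{canon p b |p b. p < Suc i \<and> b \<le> 2 ^ k}
          = insert (canon i 0) {canon p b |p b. p < i \<and> b \<le> 2 ^ k}"
        unfolding less_Suc_eq by blast
      ultimately have "collapse ` up k (Pt a (Suc i)) = collapse ` up k (Pt 0 i)"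
        using True by (simp add: collapse_up_free)
      thus ?thesis using Suc.IH[of 0] True by simp
    next
      case False
      thus ?thesis using rep_view[OF Suc.prems] by simp
    qed
  }
qed

text \<open>From \<open>bottom\<close> on, all levels form a single class.  A generator containing a point this deep
  meets all deeper levels, is therefore infinite, and so contains \<open>PInf\<close>.\<close>

lemma PInf_like_bottom:
  shows "j < k \<Longrightarrow> PInf \<in> U j \<longleftrightarrow> Pt 0 bottom \<in> U j"
    and "collapse ` up k PInf = collapse ` up k (Pt 0 bottom)"
proof -
  assume j: "j < k"
  show "PInf \<in> U j \<longleftrightarrow> Pt 0 bottom \<in> U j"
  proof
    assume "PInf \<in> U j"
    thus "Pt 0 bottom \<in> U j" using U_upward[OF j] by simp
  next
    assume *: "Pt 0 bottom \<in> U j"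
    have "Pt 0 i \<in> U j" if "bottom \<le> i" for i
      using that canon_colour[OF j, of 0 i] canon_colour[OF j, of 0 bottom] canon_bottom[OF that] *
      by simp
    hence "Pt 0 ` {bottom..} \<subseteq> U j" by auto
    moreover have "infinite (Pt 0 ` {bottom..})"
      by (simp add: finite_image_iff inj_on_def infinite_Ici)
    ultimately have "infinite (U j)" using finite_subset by blast
    thus "PInf \<in> U j" using U[OF j] by (auto simp: carrier_H)
  qed
next
  have "bottom > 0" using dull_bottom[of bottom] by (simp add: dull_def)
  then obtain m where m: "bottom = Suc m" using gr0_implies_Suc by blast
  hence "blocked bottom = {}" using dull_Suc(1)[of m] dull_bottom[of bottom] by simp
  hence "0 \<in> free bottom" by (simp add: free_def)
  note up = collapse_up_free[OF this]
  show "collapse ` up k PInf = collapse ` up k (Pt 0 bottom)"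
    unfolding up up_PInf
  proof (intro equalityI subsetI)
    fix z assume "z \<in> collapse ` points k"
    then obtain y where y: "y \<in> points k" "z = collapse y" by blast
    show "z \<in> insert (canon bottom 0) {canon p b |p b. p < bottom \<and> b \<le> 2 ^ k}"
    proof (cases y)
      case (Pt b p)
      show ?thesis
      proof (cases "p < bottom")
        case False
        thus ?thesis using y Pt canon_bottom[of p b] by simp
      qed (use y Pt in auto)
    qed (use y in simp)
  next
    fix z assume "z \<in> insert (canon bottom 0) {canon p b |p b. p < bottom \<and> b \<le> 2 ^ k}"
    then obtain p b where pb: "z = canon p b" "b \<le> 2 ^ k" by auto
    hence "Pt b p \<in> points k" "z = collapse (Pt b p)" by simp_all
    thus "z \<in> collapse ` points k" by blast
  qed
qed

lemma bisimulation_map_collapse: "bisimulation_map k U collapse"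
proof -
  have "(\<forall>j<k. x \<in> U j \<longleftrightarrow> collapse x \<in> U j) \<and> collapse ` up k x = collapse ` up k (collapse x)"
    if "x \<in> points k" for x
  proof (cases x)
    case (Pt a i)
    thus ?thesis using that canon_colour collapse_up_canon by simp
  next
    case PInf
    thus ?thesis
      using PInf_like_bottom canon_colour[of _ 0 bottom] collapse_up_canon[of 0 bottom] by simp
  qed
  thus ?thesis unfolding bisimulation_map_def by metis
qed

lemma collapse_image:
  "finite (collapse ` points k)"
  "card (collapse ` points k) \<le> ((2 ^ k + 2) + k * (3 * (2 ^ k + 2))) * (2 ^ k + 1)"
proof -
  let ?R = "(\<lambda>(i, a). Pt a i) ` ({i. \<not> dull i} \<times> {..2 ^ k})"
  have canon: "canon i a \<in> ?R" if "a \<le> 2 ^ k" for i a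
    using that
  proof (induction i arbitrary: a)
    case 0
    have "\<not> dull 0" by (simp add: dull_def)
    thus ?case using rep(1)[OF 0, of 0]
      by (intro image_eqI[where x = "(0, rep 0 a)"]) simp_all
  next
    case (Suc i)
    show ?case
    proof (cases "dull (Suc i)")
      case True
      thus ?thesis using Suc.IH[of 0] by simp
    next
      case False
      thus ?thesis using rep(1)[OF Suc.prems, of "Suc i"]
        by (intro image_eqI[where x = "(Suc i, rep (Suc i) a)"]) simp_all
    qed
  qed
  have "collapse x \<in> ?R" if "x \<in> points k" for x
    using that canon canon[of 0 bottom] by (cases x) auto
  hence sub: "collapse ` points k \<subseteq> ?R" by blast
  have fin: "finite ?R" using finite_not_dull by simp
  show "finite (collapse ` points k)" using sub fin by (rule finite_subset)
  have "card (collapse ` points k) \<le> card ?R" using fin sub by (rule card_mono)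
  also have "\<dots> \<le> card ({i. \<not> dull i} \<times> {..2 ^ k :: nat})"
    using finite_not_dull by (intro card_image_le) simp
  also have "\<dots> = card {i. \<not> dull i} * (2 ^ k + 1)" by (simp add: card_cartesian_product)
  also have "\<dots> \<le> ((2 ^ k + 2) + k * (3 * (2 ^ k + 2))) * (2 ^ k + 1)"
    using card_not_dull by (rule mult_right_mono) simp
  finally show "card (collapse ` points k) \<le> ((2 ^ k + 2) + k * (3 * (2 ^ k + 2))) * (2 ^ k + 1)" .
qed

end

section \<open>Generating the whole algebra\<close>

text \<open>Numbering the columns from the right makes the last column the one that lies in no generator.
  The choice matters: if column \<open>0\<close> had the empty colour, then for \<open>k = 0\<close> the points
  \<open>Pt 0 0\<close> and \<open>Pt 0 1\<close> would be indistinguishable and the generated algebra finite.\<close>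

definition bit_gen :: "nat \<Rightarrow> nat \<Rightarrow> pt set" where
  "bit_gen k j = {Pt l 0 |l. l \<le> 2 ^ k \<and> bit (2 ^ k - l) j}"

lemma bit_gen_carrier: "bit_gen k j \<in> carrier (H k)"
proof -
  have "bit_gen k j \<subseteq> {Pt l i |l i. l \<le> 2 ^ k \<and> i \<le> 0}" by (auto simp: bit_gen_def)
  hence "finite (bit_gen k j)" using finite_levels finite_subset by blast
  moreover have "y \<in> bit_gen k j" if "x \<in> bit_gen k j" "pt_le k x y" for x y
    using that by (cases y) (auto simp: bit_gen_def)
  hence "is_upset k (bit_gen k j)" by (auto simp: is_upset_def) (auto simp: bit_gen_def)
  ultimately show ?thesis by (simp add: carrier_H)
qed

lemma bits_upto_eq:
  assumes "m \<le> 2 ^ k" "n \<le> (2 :: nat) ^ k" "\<And>j. j \<le> k \<Longrightarrow> bit m j \<longleftrightarrow> bit n j"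
  shows "m = n"
proof (rule bit_eqI)
  fix j
  have "m' < 2 ^ j" if "k < j" "m' \<le> 2 ^ k" for m' :: nat
    using that power_strict_increasing[of k j "2 :: nat"] by linarith
  thus "bit m j \<longleftrightarrow> bit n j"
    using assms by (cases "j \<le> k") (auto simp: bit_iff_odd)
qed

lemma inj_bit_gen: "inj_on (bit_gen k) {..k}"
proof (rule inj_onI)
  fix i j assume ij: "i \<in> {..k}" "j \<in> {..k}" "bit_gen k i = bit_gen k j"
  have "(2 :: nat) ^ i \<le> 2 ^ k" using ij by simp
  hence "Pt (2 ^ k - 2 ^ i) 0 \<in> bit_gen k i'  \<longleftrightarrow> i' = i" for i'
    by (auto simp: bit_gen_def bit_exp_iff)
  thus "i = j" using ij(3) by metis
qed

definition above :: "nat \<Rightarrow> nat \<Rightarrow> pt set" where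
  "above k m = {Pt b p |b p. b \<le> 2 ^ k \<and> p < m}"

locale bit_gen_subalgebra =
  fixes k :: nat and S :: "pt set set"
  assumes sub: "subalgebra (H k) S" and gens: "j \<le> k \<Longrightarrow> bit_gen k j \<in> S"
begin

lemma S_ops:
  "{} \<in> S" "points k \<in> S"
  "X \<in> S \<Longrightarrow> Y \<in> S \<Longrightarrow> X \<inter> Y \<in> S" "X \<in> S \<Longrightarrow> Y \<in> S \<Longrightarrow> X \<union> Y \<in> S"
  "X \<in> S \<Longrightarrow> Y \<in> S \<Longrightarrow> points k - down k (X - Y) \<in> S"
  using sub by (simp_all add: subalgebra_def closed_under_ops_def H_simps)

lemma S_Union:
  assumes "finite I" "\<And>i. i \<in> I \<Longrightarrow> X i \<in> S"
  shows "(\<Union>i\<in>I. X i) \<in> S"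
  using assms by (induction I rule: finite_induct) (auto intro: S_ops)

lemma S_Inter:
  assumes "finite I" "\<And>i. i \<in> I \<Longrightarrow> X i \<in> S"
  shows "points k \<inter> (\<Inter>i\<in>I. X i) \<in> S"
  using assms
proof (induction I rule: finite_induct)
  case (insert i I)
  have "X i \<in> S" "points k \<inter> (\<Inter>i\<in>I. X i) \<in> S" using insert by simp_all
  hence "X i \<inter> (points k \<inter> (\<Inter>i\<in>I. X i)) \<in> S" by (rule S_ops(3))
  thus ?case by (simp add: Int_left_commute)
qed (simp add: S_ops)

text \<open>The points of level \<open>0\<close> that lie in the generators for the digits \<open>1\<close> of \<open>2 ^ k - a\<close>
  and, using the pseudocomplement, in none of those for the digits \<open>0\<close>.  For
  \<open>a = 2 ^ k\<close> only the second condition remains; it excludes the deeper points because all of them see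
  \<open>Pt 0 0\<close>.\<close>

lemma top_point_in_S:
  assumes a: "a \<le> 2 ^ k"
  shows "up k (Pt a 0) \<in> S"
proof -
  define E where "E = {j. j \<le> k \<and> bit (2 ^ k - a) j}"
  define X where "X = points k \<inter> (\<Inter>j\<in>E. bit_gen k j)"
  define Y where "Y = (\<Union>j\<in>{..k} - E. bit_gen k j)"
  have "X \<in> S" "Y \<in> S"
    unfolding X_def Y_def by (auto intro!: S_Inter S_Union gens simp: E_def)
  hence "X \<inter> (points k - down k (Y - {})) \<in> S" by (intro S_ops)
  moreover have "z \<in> X \<inter> (points k - down k (Y - {})) \<longleftrightarrow> z = Pt a 0" for z
  proof
    assume "z = Pt a 0"
    moreover have "Pt a 0 \<in> X" using a by (auto simp: X_def bit_gen_def E_def)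
    moreover have "Pt a 0 \<notin> down k Y"
      by (auto simp: down_def Y_def bit_gen_def E_def)
    ultimately show "z \<in> X \<inter> (points k - down k (Y - {}))" by (auto simp: X_def)
  next
    assume z: "z \<in> X \<inter> (points k - down k (Y - {}))"
    show "z = Pt a 0"
    proof (cases "\<exists>l. z = Pt l 0")
      case True
      then obtain l where l: "z = Pt l 0" by blast
      have "l \<le> 2 ^ k" using z l by simp
      hence "z \<notin> Y" using z l by (auto simp: down_def)
      have "2 ^ k - l = 2 ^ k - a"
      proof (rule bits_upto_eq)
        fix j assume "j \<le> k"
        thus "bit (2 ^ k - l) j \<longleftrightarrow> bit (2 ^ k - a) j"
          using z \<open>z \<notin> Y\<close> \<open>l \<le> 2 ^ k\<close> unfolding X_def Y_def bit_gen_def E_def l by auto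
      qed auto
      thus ?thesis using l a \<open>l \<le> 2 ^ k\<close> by simp
    next
      case False
      hence "z \<notin> bit_gen k j" for j by (auto simp: bit_gen_def)
      hence "E = {}" using z unfolding X_def by blast
      hence "Pt 0 0 \<in> Y" by (auto simp: Y_def bit_gen_def bit_exp_iff intro!: bexI[of _ k])
      moreover have "pt_le k z (Pt 0 0)"
        using z False
      proof (cases z)
        case (Pt b p)
        thus ?thesis using z False by (cases p) auto
      qed auto
      ultimately have "z \<in> down k Y" using z by (auto simp: down_def)
      thus ?thesis using z by simp
    qed
  qed
  hence "X \<inter> (points k - down k (Y - {})) = {Pt a 0}" by blast
  moreover have "y = Pt a 0" if "y \<in> up k (Pt a 0)" for y
    using that by (cases y) (auto simp: up_def)
  hence "up k (Pt a 0) = {Pt a 0}" using mem_up_self[of "Pt a 0" k] a by auto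
  ultimately show ?thesis by simp
qed

text \<open>For \<open>a < 2 ^ k\<close> the upset of \<open>Pt a (i + 1)\<close> consists of the points that are not below
  \<open>Pt (a + 1) i\<close>, that is, the relative pseudocomplement \<open>up k (Pt (a + 1) i) \<rightarrow> above k i\<close>.  The last
  column misses nothing; its upset consists of the points that are not below any other point of level
  \<open>i + 1\<close>.\<close>

lemma up_in_S: "above k i \<in> S \<and> (\<forall>a \<le> 2 ^ k. up k (Pt a i) \<in> S)"
proof (induction i)
  case 0
  thus ?case using top_point_in_S by (simp add: above_def S_ops)
next
  case (Suc i)
  have "z \<in> above k (Suc i) \<longleftrightarrow> z \<in> above k i \<union> (\<Union>a\<in>{..2 ^ k}. up k (Pt a i))" for z
    by (cases z) (auto simp: above_def up_def less_Suc_eq)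
  hence "above k (Suc i) = above k i \<union> (\<Union>a\<in>{..2 ^ k}. up k (Pt a i))" by blast
  also have "\<dots> \<in> S" using Suc.IH by (intro S_ops S_Union) auto
  finally have above: "above k (Suc i) \<in> S" .
  have low: "up k (Pt a (Suc i)) \<in> S" if a: "a < 2 ^ k" for a
  proof -
    have "z \<in> up k (Pt (a + 1) i) - above k i \<longleftrightarrow> z = Pt (a + 1) i" for z
      using a by (cases z) (auto simp: above_def up_def)
    hence "up k (Pt (a + 1) i) - above k i = {Pt (a + 1) i}" by blast
    moreover have "z \<in> up k (Pt a (Suc i)) \<longleftrightarrow> z \<in> points k - down k {Pt (a + 1) i}" for z
      using a by (cases z) (auto simp: up_def down_def)
    hence "up k (Pt a (Suc i)) = points k - down k {Pt (a + 1) i}" by blast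
    moreover have "points k - down k (up k (Pt (a + 1) i) - above k i) \<in> S"
      using Suc.IH a by (intro S_ops) auto
    ultimately show ?thesis by simp
  qed
  define W where "W = (\<Union>b\<in>{..<2 ^ k}. up k (Pt b (Suc i)))"
  have "W \<in> S" unfolding W_def using low by (intro S_Union) auto
  hence "points k - down k (W - above k (Suc i)) \<in> S" using above by (intro S_ops)
  moreover have "z \<in> W - above k (Suc i) \<longleftrightarrow> z \<in> {Pt b (Suc i) |b. b < 2 ^ k}" for z
    by (cases z) (auto simp: W_def above_def up_def)
  hence "W - above k (Suc i) = {Pt b (Suc i) |b. b < 2 ^ k}" by blast
  moreover have "z \<in> up k (Pt (2 ^ k) (Suc i)) \<longleftrightarrow>
      z \<in> points k - down k {Pt b (Suc i) |b. b < 2 ^ k}" for z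
  proof (cases z)
    case (Pt b p)
    have "pt_le k (Pt b p) (Pt 0 (Suc i))" if "Suc (Suc i) \<le> p" "b \<le> 2 ^ k"
      using that by auto
    moreover have "(0 :: nat) < 2 ^ k" by simp
    ultimately have "(\<exists>c < 2 ^ k. pt_le k (Pt b p) (Pt c (Suc i))) \<longleftrightarrow>
        b \<le> 2 ^ k \<and> (p = Suc i \<and> b < 2 ^ k \<or> Suc (Suc i) \<le> p)"
      by fastforce
    hence "z \<in> down k {Pt b (Suc i) |b. b < 2 ^ k} \<longleftrightarrow>
        b \<le> 2 ^ k \<and> (p = Suc i \<and> b < 2 ^ k \<or> Suc (Suc i) \<le> p)"
      using Pt by (auto simp: down_def)
    thus ?thesis using Pt by (auto simp: up_def)
  next
    case PInf
    have "Pt 0 (Suc i) \<in> {Pt b (Suc i) |b. b < 2 ^ k}" "pt_le k PInf (Pt 0 (Suc i))" by simp_all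
    hence "z \<in> down k {Pt b (Suc i) |b. b < 2 ^ k}"
      unfolding down_def PInf using PInf_mem_points by blast
    thus ?thesis using PInf by (simp add: up_def)
  qed
  hence "up k (Pt (2 ^ k) (Suc i)) = points k - down k {Pt b (Suc i) |b. b < 2 ^ k}" by blast
  ultimately have "up k (Pt (2 ^ k) (Suc i)) \<in> S" by simp
  thus ?case using above low by (auto simp: le_less)
qed

lemma carrier_subset_S: "carrier (H k) \<subseteq> S"
proof
  fix V assume V: "V \<in> carrier (H k)"
  show "V \<in> S"
  proof (cases "V = points k")
    case False
    hence up: "is_upset k V" and fin: "finite V" using V by (auto simp: carrier_H)
    have "up k x \<in> S" if "x \<in> V" for x
    proof (cases x)
      case (Pt a i)
      thus ?thesis using up_in_S[of i] up that by (auto simp: is_upset_def)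
    next
      case PInf
      thus ?thesis using upset_PInf[OF up] that False by simp
    qed
    hence "(\<Union>x\<in>V. up k x) \<in> S" by (rule S_Union[OF fin])
    thus ?thesis using upset_eq_Union_up[OF up] by simp
  qed (simp add: S_ops)
qed

end

lemma generated_by_card_H: "generated_by_card (k + 1) (H k)"
  unfolding generated_by_card_def
proof (intro exI[of _ "bit_gen k ` {..k}"] conjI)
  show "bit_gen k ` {..k} \<subseteq> carrier (H k)" using bit_gen_carrier by blast
  show "card (bit_gen k ` {..k}) = k + 1" by (simp add: card_image inj_bit_gen)
  have "carrier (H k) \<subseteq> S" if "subalgebra (H k) S" "bit_gen k ` {..k} \<subseteq> S" for S
    using that by (intro bit_gen_subalgebra.carrier_subset_S) (auto simp: bit_gen_subalgebra_def)
  moreover have "subalgebra (H k) (carrier (H k))"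
    by (simp add: subalgebra_def closed_H)
  ultimately show "generated_subalgebra (H k) (bit_gen k ` {..k}) = carrier (H k)"
    using \<open>bit_gen k ` {..k} \<subseteq> carrier (H k)\<close> unfolding generated_subalgebra_def by blast
qed simp

lemma infinite_carrier_H: "infinite (carrier (H k))"
proof
  assume "finite (carrier (H k))"
  moreover have "range (\<lambda>i. up k (Pt 0 i)) \<subseteq> carrier (H k)"
    by (auto simp: carrier_H is_upset_up finite_up)
  ultimately have "finite (range (\<lambda>i. up k (Pt 0 i)))" by (rule rev_finite_subset)
  moreover have "inj (\<lambda>i. up k (Pt 0 i))"
  proof (rule injI)
    fix i j assume "up k (Pt 0 i) = up k (Pt 0 j)"
    hence "Pt 0 i \<in> up k (Pt 0 j)" "Pt 0 j \<in> up k (Pt 0 i)"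
      using mem_up_self[of "Pt 0 i" k] mem_up_self[of "Pt 0 j" k] by auto
    thus "i = j" by (auto simp: up_def)
  qed
  ultimately show False by (auto dest: finite_imageD)
qed

lemma countable_carrier_H: "countable (carrier (H k))"
proof -
  have "points k \<subseteq> insert PInf (range (case_prod Pt))" by (auto simp: points_def)
  hence "countable (points k)" by (rule countable_subset) auto
  hence "countable (insert (points k) {V. finite V \<and> V \<subseteq> points k})"
    by (intro countable_insert countable_Collect_finite_subset)
  moreover have "carrier (H k) \<subseteq> insert (points k) {V. finite V \<and> V \<subseteq> points k}"
    by (auto simp: carrier_H is_upset_def)
  ultimately show ?thesis by (rule countable_subset[rotated])
qed

lemma regularly_k_finite_variety_V: "regularly_k_finite k (variety_V k :: 'a heyting_alg set)"
proof -
  have "\<exists>\<rho> :: pt \<Rightarrow> pt. bisimulation_map k U \<rho> \<and> finite (\<rho> ` points k) \<and>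
      card (\<rho> ` points k) \<le> ((2 ^ k + 2) + k * (3 * (2 ^ k + 2))) * (2 ^ k + 1)"
    if "\<And>j. j < k \<Longrightarrow> U j \<in> carrier (H k)" for U
  proof -
    interpret colouring k U using that by unfold_locales
    show ?thesis using bisimulation_map_collapse collapse_image by blast
  qed
  then obtain T where "finite T" "T \<subseteq> terms_in k"
    "\<And>t. t \<in> terms_in k \<Longrightarrow> \<exists>t'\<in>T. valid_eq (H k) t t'"
    by (rule finitely_many_terms) blast+
  thus ?thesis
    unfolding variety_V_def by (rule regularly_k_finite_if_finitely_many_terms)
qed

lemma not_Suc_k_finite_variety_V:
  assumes "infinite (UNIV :: 'a set)"
  shows "\<not> k_finite (k + 1) (variety_V k :: 'a heyting_alg set)"
proof -
  obtain g :: "nat \<Rightarrow> 'a" where g: "inj g"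
    using infinite_countable_subset[OF assms] by blast
  define f where "f = g \<circ> to_nat_on (carrier (H k))"
  have "inj_on f (carrier (H k))"
    unfolding f_def using countable_carrier_H g
    by (intro comp_inj_on inj_on_to_nat_on) (auto intro: inj_on_subset)
  then obtain A where A: "heyting_hom (H k) A f" "bij_betw f (carrier (H k)) (carrier A)"
    using heyting_copy[OF closed_H] by blast
  have "heyting_algebra A" using heyting_algebra_iso[OF heyting_algebra_H A] .
  moreover have "valid_eq A s t" if "valid_eq (H k) s t" for s t
    using valid_eq_iso[OF closed_H A that] .
  ultimately have "A \<in> variety_V k"
    by (simp add: variety_V_def generated_variety_def)
  moreover have "generated_by_card (k + 1) A"
    using generated_by_card_iso[OF closed_H A generated_by_card_H] .
  moreover have "infinite (carrier A)"
    using infinite_carrier_H bij_betw_finite[OF A(2)] by blast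
  ultimately show ?thesis by (auto simp: k_finite_def)
qed

theorem theorem19:
  fixes k :: nat
  shows "regularly_k_finite k (variety_V k :: 'a heyting_alg set) \<and>
         (infinite (UNIV :: 'a set) \<longrightarrow> \<not> k_finite (k + 1) (variety_V k :: 'a heyting_alg set))"
  using regularly_k_finite_variety_V not_Suc_k_finite_variety_V by blast

end
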